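(* Let $\{X_n\}_{n\in\mathbb{Z}}$ be a real second-order stationary series exhibiting cyclical long memory in the spectral domain, that is, with spectral density $$f_X(\lambda)=\begin{cases}(c_f^-+R_f^-(\lambda_0-\lambda))(\lambda_0-\lambda)^{-2d},&0<\lambda<\lambda_0,\\(c_f^++R_f^+(\lambda-\lambda_0))(\lambda-\lambda_0)^{-2d},&\lambda_0<\lambda<\pi,\end{cases}$$ where $\lambda_0\in(0,\pi)$, $d\in(0,1/2)$, and $R_f^\pm(x)\to0$ as $x\to0^+$. Suppose that $$R_f^\pm(x)=L_f^\pm\left(\frac1x\right)-c_f^\pm,$$ where $L_f^-:\left(\frac1{\lambda_0},\infty\right)\to(0,\infty)$ and $L_f^+:\left(\frac1{\pi-\lambda_0},\infty\right)\to(0,\infty)$ are quasi-monotone slowly varying functions at $+\infty$ with $L_f^\pm(x)\sim c_f^\pm\in(0,\infty)$ as $x\to+\infty$. Then $X$ exhibits cyclical long memory in the time domain with the same $\lambda_0$ and $d$, that is, its autocovariance function satisfies $$\gamma_X(h)=\big(c_\gamma\cos(\lambda_0h+\phi)+R_\gamma(h)\big)h^{2d-1},\quad h\in\mathbb{N}_0,$$ where $R_\gamma(h)\to0$ as $h\to+\infty$, $c_\gamma\in(0,\infty)$, $\phi\in\left[-\left(\tfrac12-d\right)\pi,\left(\tfrac12-d\right)\pi\right]$, and $$c_\gamma=2\Gamma(1-2d)\sqrt{(c_f^+)^2+(c_f^-)^2-2c_f^+c_f^-\left(\cos(2\pi d)\right)^2},$$ $$\phi=\arcsin\left(\frac{(c_f^+-c_f^-)\cos(\pi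 d)}{\sqrt{(c_f^+)^2+(c_f^-)^2-2c_f^+c_f^-\left(\cos(2\pi d)\right)^2}}\right).$$
   Context: The series has zero mean, its spectral density is even on $(-\pi,\pi)$, and $\gamma_X(h)=\mathbb{E}X_hX_0=2\int_0^\pi\cos(h\lambda)f_X(\lambda)\,d\lambda$. A slowly varying function $L:[0,\infty)\to(0,\infty)$ at infinity is called quasi-monotone if (i) it is of bounded variation on any compact interval of $[0,\infty)$, and (ii) for some $\delta>0$, $\int_0^xu^\delta|dL(u)|=O(x^\delta L(x))$ as $x\to\infty$; the same term is used for the functions $L_f^\pm$, which are given on half-lines $(a,\infty)$ with $a>0$.
   Formalization: Under both square roots cos(2πd) stands to the first power instead of its square (the printed formula is false unless d=1/4, e.g. for L±=c±=1, d=1/3), and the identity for γ_X(h) is stated for h≥1, since h^{2d-1} is undefined at h=0. *)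

theory Defs
  imports "HOL-Probability.Probability" "HOL-Library.Landau_Symbols"
begin

definition covariance :: "'w measure \<Rightarrow> ('w \<Rightarrow> real) \<Rightarrow> ('w \<Rightarrow> real) \<Rightarrow> real" where
  "covariance M Y Z =
     (LINT \<omega>|M. (Y \<omega> - (LINT \<omega>'|M. Y \<omega>')) * (Z \<omega> - (LINT \<omega>'|M. Z \<omega>')))"

definition second_order_stationary :: "'w measure \<Rightarrow> (int \<Rightarrow> 'w \<Rightarrow> real) \<Rightarrow> bool" where
  "second_order_stationary M X \<longleftrightarrow>
     (\<forall>n. X n \<in> borel_measurable M \<and> integrable M (\<lambda>\<omega>. (X n \<omega>)\<^sup>2)) \<and>
     (\<forall>m n. (LINT \<omega>|M. X m \<omega>) = (LINT \<omega>|M. X n \<omega>)) \<and>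
     (\<forall>h m n. covariance M (X (m + h)) (X m) = covariance M (X (n + h)) (X n))"

text \<open>The autocovariance function of a series with zero mean.\<close>

definition autocovariance :: "'w measure \<Rightarrow> (int \<Rightarrow> 'w \<Rightarrow> real) \<Rightarrow> int \<Rightarrow> real" where
  "autocovariance M X h = (LINT \<omega>|M. X h \<omega> * X 0 \<omega>)"

definition spectral_density :: "'w measure \<Rightarrow> (int \<Rightarrow> 'w \<Rightarrow> real) \<Rightarrow> (real \<Rightarrow> real) \<Rightarrow> bool" where
  "spectral_density M X f \<longleftrightarrow>
     (\<forall>l\<in>{-pi<..<pi}. 0 \<le> f l \<and> f (- l) = f l) \<and>
     set_integrable lborel {-pi<..<pi} f \<and>
     (\<forall>h. autocovariance M X h = 2 * (LINT l:{0<..<pi}|lborel. cos (of_int h * l) * f l))"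

definition slowly_varying_on :: "real \<Rightarrow> (real \<Rightarrow> real) \<Rightarrow> bool" where
  "slowly_varying_on a L \<longleftrightarrow>
     (\<forall>x>a. 0 < L x) \<and> set_borel_measurable borel {a<..} L \<and>
     (\<forall>t>0. ((\<lambda>x. L (t * x) / L x) \<longlongrightarrow> 1) at_top)"

text \<open>The cells of a division are compact intervals, so \<open>Inf K\<close> and \<open>Sup K\<close> are
  their end points; degenerate cells contribute nothing.\<close>

definition variation_sums :: "(real \<Rightarrow> real) \<Rightarrow> real \<Rightarrow> real \<Rightarrow> real set" where
  "variation_sums g s t = {(\<Sum>K\<in>D. \<bar>g (Sup K) - g (Inf K)\<bar>) | D. D division_of {s..t}}"

definition bounded_variation_on :: "(real \<Rightarrow> real) \<Rightarrow> real \<Rightarrow> real \<Rightarrow> bool" where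
  "bounded_variation_on g s t \<longleftrightarrow> bdd_above (variation_sums g s t)"

definition total_variation :: "(real \<Rightarrow> real) \<Rightarrow> real \<Rightarrow> real \<Rightarrow> real" where
  "total_variation g s t = Sup (variation_sums g s t)"

text \<open>The Riemann--Stieltjes integral of \<open>w\<close> with respect to \<open>v\<close> over \<open>{s..t}\<close>, as a limit
  along tagged divisions whose mesh tends to zero (a constant gauge).\<close>

definition has_RS_integral ::
    "(real \<Rightarrow> real) \<Rightarrow> (real \<Rightarrow> real) \<Rightarrow> real \<Rightarrow> real \<Rightarrow> real \<Rightarrow> bool" where
  "has_RS_integral w v s t I \<longleftrightarrow>
     (\<forall>e>0. \<exists>r>0. \<forall>p. p tagged_division_of {s..t} \<and> (\<lambda>x. ball x r) fine p \<longrightarrow>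
        \<bar>(\<Sum>(x, K)\<in>p. w x * (v (Sup K) - v (Inf K))) - I\<bar> < e)"

text \<open>The integral of \<open>w(u) |dL(u)|\<close> over \<open>(a, x]\<close>: the measure \<open>|dL|\<close> is that of the
  variation function of \<open>L\<close>. As \<open>L\<close> need not be defined at \<open>a\<close>, the integral is improper at
  the lower end; its value \<open>I\<close> is finite.\<close>

definition has_variation_integral ::
    "(real \<Rightarrow> real) \<Rightarrow> (real \<Rightarrow> real) \<Rightarrow> real \<Rightarrow> real \<Rightarrow> real \<Rightarrow> bool" where
  "has_variation_integral w L a x I \<longleftrightarrow>
     (\<exists>G. (\<forall>s. a < s \<and> s \<le> x \<longrightarrow> has_RS_integral w (total_variation L s) s x (G s)) \<and>
          (G \<longlongrightarrow> I) (at_right a))"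

text \<open>Quasi-monotone slowly varying functions on the open half-line \<open>(a, \<infinity>)\<close>, \<open>a > 0\<close>.\<close>

definition quasi_monotone_slowly_varying :: "real \<Rightarrow> (real \<Rightarrow> real) \<Rightarrow> bool" where
  "quasi_monotone_slowly_varying a L \<longleftrightarrow>
     slowly_varying_on a L \<and>
     (\<forall>s t. a < s \<and> s \<le> t \<longrightarrow> bounded_variation_on L s t) \<and>
     (\<exists>\<delta>>0. \<exists>J. (\<forall>x>a. has_variation_integral (\<lambda>u. u powr \<delta>) L a x (J x)) \<and>
        J \<in> O[at_top](\<lambda>x. x powr \<delta> * L x))"

text \<open>With \<open>\<theta> = (1/2 - d) \<pi>\<close>, the two sides of the singularity contribute
  \<open>2 \<Gamma>(1 - 2d) (cp cos(\<lambda>\<^sub>0 h + \<theta>) + cm cos(\<lambda>\<^sub>0 h - \<theta>)) h powr (2d - 1)\<close>, and this is the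
  amplitude of the trigonometric sum. The cosine enters to the first power: the
  published formula has its square, a misprint that agrees with this
  expression only for \<open>d = 1/4\<close>.\<close>

definition cyclical_amplitude :: "real \<Rightarrow> real \<Rightarrow> real \<Rightarrow> real" where
  "cyclical_amplitude cm cp d = sqrt (cp\<^sup>2 + cm\<^sup>2 - 2 * cp * cm * cos (2 * pi * d))"

end

(* Only the variation of L over dyadic blocks matters: condition (ii) bounds it, because
   the variation integral over (a, x] dominates (m/2)^delta times the variation over [m, x].
   By the second mean value theorem each block contributes O(1/h) times the size of the
   integrand to the Fourier integral of L(1/x) x^(-2d), and the geometric sum over blocks shows
   that the part beyond N/h is negligible, uniformly in h, for large N.
   Hence L(1/x) may be replaced by c exp(-x), which has the same limit c at 0 and whose
   Fourier integral against x^(-2d) is a Gamma integral in closed form,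
   Gamma(s) (1 - ih)^(-s) with s = 1 - 2d. Adding the two sides of the
   singularity, with phases theta and -theta, theta = (1/2 - d) pi, gives the cosine. *)

theory Submission
  imports Defs
begin

section \<open>Fourier integrals of functions of bounded variation\<close>

text \<open>The constant for the dyadic blocks never becomes small. Smallness has two sources:
  beyond N/h the factor N^(-e), with e = 2d, and before N/h the convergence of the coefficient of
  x^(-e) to 0, which is why its limit c is subtracted. Both parts scale like h^(e - 1), so N is
  fixed first, then the tolerance near 0, then h. The comparison is with c exp(-x) rather than c
  because it is absolutely integrable against x^(-e) on the whole half-line, yet still monotone, so
  that subtracting it stays in the same class of functions. Two obstacles shape the rest. L is given
  on an open half-line only, so bounds on L(1/x) hold for 0 < x < b, and b is reached by continuity
  of the integral; that the improper integral in (ii) is finite keeps the variation bounded down to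
  a. And once the singularity is moved to 0, the phase is lambda_0 h up to sign and moves with h; it
  is handled by combining the limits for the fixed phases 0 and pi/2.\<close>

lemma abs_integral_cos_le:
  fixes h \<psi> :: real
  assumes "a \<le> b" "0 < h"
  shows "\<bar>integral {a..b} (\<lambda>x. cos (h * x + \<psi>))\<bar> \<le> 2 / h"
proof -
  have "((\<lambda>x. cos (h * x + \<psi>)) has_integral (sin (h * b + \<psi>) / h - sin (h * a + \<psi>) / h)) {a..b}"
    using assms
    by (intro fundamental_theorem_of_calculus)
       (auto intro!: derivative_eq_intros simp flip: has_real_derivative_iff_has_vector_derivative)
  then have "integral {a..b} (\<lambda>x. cos (h * x + \<psi>)) = (sin (h * b + \<psi>) - sin (h * a + \<psi>)) / h"
    by (simp add: integral_unique diff_divide_distrib)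
  moreover have "\<bar>sin (h * b + \<psi>) - sin (h * a + \<psi>)\<bar> \<le> 2"
    using abs_sin_le_one[of "h * b + \<psi>"] abs_sin_le_one[of "h * a + \<psi>"] by linarith
  ultimately show ?thesis
    using assms by (simp add: divide_right_mono)
qed

text \<open>Only the end-point values of \<open>g\<close> enter, whatever the length of the
  interval, and \<open>g\<close> may jump: the second mean value theorem yields integrability as
  well.\<close>

lemma monotone_times_cos:
  fixes g :: "real \<Rightarrow> real"
  assumes "a \<le> b" "0 < h" "\<And>x y. a \<le> x \<Longrightarrow> x \<le> y \<Longrightarrow> y \<le> b \<Longrightarrow> g x \<le> g y"
  shows "(\<lambda>x. g x * cos (h * x + \<psi>)) integrable_on {a..b}"
    and "\<bar>integral {a..b} (\<lambda>x. g x * cos (h * x + \<psi>))\<bar> \<le> 2 / h * (\<bar>g a\<bar> + \<bar>g b\<bar>)"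
proof -
  have int: "(\<lambda>x. cos (h * x + \<psi>)) integrable_on {a..b}"
    by (intro integrable_continuous_real continuous_intros)
  obtain c where c: "c \<in> {a..b}"
    and hi: "((\<lambda>x. g x * cos (h * x + \<psi>)) has_integral
       (g a * integral {a..c} (\<lambda>x. cos (h * x + \<psi>)) + g b * integral {c..b} (\<lambda>x. cos (h * x + \<psi>)))) {a..b}"
    using second_mean_value_theorem_full[OF int assms(1), of g] assms(3) by blast
  show "(\<lambda>x. g x * cos (h * x + \<psi>)) integrable_on {a..b}"
    using hi by blast
  have "\<bar>g a * integral {a..c} (\<lambda>x. cos (h * x + \<psi>)) + g b * integral {c..b} (\<lambda>x. cos (h * x + \<psi>))\<bar>
      \<le> \<bar>g a\<bar> * (2 / h) + \<bar>g b\<bar> * (2 / h)"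
    using c assms(2) abs_integral_cos_le[of a c h \<psi>] abs_integral_cos_le[of c b h \<psi>]
    by (intro order_trans[OF abs_triangle_ineq] add_mono)
       (auto simp only: abs_mult atLeastAtMost_iff intro!: mult_left_mono)
  then show "\<bar>integral {a..b} (\<lambda>x. g x * cos (h * x + \<psi>))\<bar> \<le> 2 / h * (\<bar>g a\<bar> + \<bar>g b\<bar>)"
    using hi by (simp add: integral_unique algebra_simps)
qed

text \<open>Jordan decomposition g = u - v into increasing functions. It suffices that
  \<open>w\<close> dominates the increments of \<open>g\<close>; this leaves room for a product-rule
  bound in place of the exact variation.\<close>

lemma bounded_variation_times_cos:
  fixes g w :: "real \<Rightarrow> real"
  assumes ab: "a \<le> b" and h: "0 < h"
    and w: "\<And>x y. a \<le> x \<Longrightarrow> x \<le> y \<Longrightarrow> y \<le> b \<Longrightarrow> \<bar>g y - g x\<bar> \<le> w y - w x"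
    and B: "\<bar>g a\<bar> \<le> B" "\<bar>g b\<bar> \<le> B" and V: "w b - w a \<le> V"
  shows "(\<lambda>x. g x * cos (h * x + \<psi>)) integrable_on {a..b}"
    and "\<bar>integral {a..b} (\<lambda>x. g x * cos (h * x + \<psi>))\<bar> \<le> 4 / h * (B + V)"
proof -
  define u where "u x = w x - w a" for x
  define v where "v x = u x - g x" for x
  have u: "u x \<le> u y" and v: "v x \<le> v y" if "a \<le> x" "x \<le> y" "y \<le> b" for x y
    using w[OF that] by (auto simp: u_def v_def)
  note U = monotone_times_cos[where g = u and \<psi> = \<psi>, OF ab h u]
    and V' = monotone_times_cos[where g = v and \<psi> = \<psi>, OF ab h v]
  have eq: "g x * cos (h * x + \<psi>) = u x * cos (h * x + \<psi>) - v x * cos (h * x + \<psi>)" for x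
    by (simp add: v_def algebra_simps)
  show "(\<lambda>x. g x * cos (h * x + \<psi>)) integrable_on {a..b}"
    unfolding eq using U(1) V'(1) by (intro integrable_diff) auto
  have "integral {a..b} (\<lambda>x. g x * cos (h * x + \<psi>)) =
      integral {a..b} (\<lambda>x. u x * cos (h * x + \<psi>)) - integral {a..b} (\<lambda>x. v x * cos (h * x + \<psi>))"
    unfolding eq using U(1) V'(1) by (intro integral_diff) auto
  then have "\<bar>integral {a..b} (\<lambda>x. g x * cos (h * x + \<psi>))\<bar> \<le>
      2 / h * (\<bar>u a\<bar> + \<bar>u b\<bar>) + 2 / h * (\<bar>v a\<bar> + \<bar>v b\<bar>)"
    using U(2) V'(2) by linarith
  also have "\<dots> = 2 / h * (\<bar>u a\<bar> + \<bar>u b\<bar> + \<bar>v a\<bar> + \<bar>v b\<bar>)"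
    by (simp add: algebra_simps)
  \<comment> \<open>Since \<open>u a = 0\<close>, the four terms are at most 0, V, B and V +
    B.\<close>
  also have "\<dots> \<le> 2 / h * (2 * (B + V))"
  proof (intro mult_left_mono)
    show "\<bar>u a\<bar> + \<bar>u b\<bar> + \<bar>v a\<bar> + \<bar>v b\<bar> \<le> 2 * (B + V)"
      using B V u[of a b] ab by (simp add: u_def v_def)
  qed (use h in auto)
  finally show "\<bar>integral {a..b} (\<lambda>x. g x * cos (h * x + \<psi>))\<bar> \<le> 4 / h * (B + V)"
    by simp
qed

text \<open>\<open>W x y\<close> abstracts the variation over [x, y]. Superadditivity makes the
  increments of \<open>W s\<close> dominate those of \<open>G\<close>. Only blocks of ratio at most
  2 have bounded variation; the variation down to 0 may be infinite.\<close>

definition dyadically_bounded_variation ::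
    "(real \<Rightarrow> real) \<Rightarrow> real \<Rightarrow> (real \<Rightarrow> real \<Rightarrow> real) \<Rightarrow> real \<Rightarrow> bool" where
  "dyadically_bounded_variation G b W C \<longleftrightarrow>
     (\<forall>x\<in>{0<..<b}. \<bar>G x\<bar> \<le> C) \<and>
     (\<forall>x y. 0 < x \<longrightarrow> x \<le> y \<longrightarrow> y < b \<longrightarrow> \<bar>G y - G x\<bar> \<le> W x y) \<and>
     (\<forall>x y z. 0 < x \<longrightarrow> x \<le> y \<longrightarrow> y \<le> z \<longrightarrow> z < b \<longrightarrow> W x y + W y z \<le> W x z) \<and>
     (\<forall>x y. 0 < x \<longrightarrow> x \<le> y \<longrightarrow> y < b \<longrightarrow> y \<le> 2 * x \<longrightarrow> W x y \<le> C)"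

text \<open>Product rule for the variation: the increments of \<open>G\<close> are weighted by the
  largest power \<open>s powr -e\<close>, those of the decreasing power by C. The bound 4 (B + V) /
  h with B = C s^(-e) and V = 2 C s^(-e) gives the 12.\<close>

lemma dyadic_block_bound:
  assumes G: "dyadically_bounded_variation G b W C" and "0 < e" "0 < h"
    and ab: "0 < s" "s \<le> t" "t < b" "t \<le> 2 * s"
  shows "(\<lambda>x. G x * x powr -e * cos (h * x + \<psi>)) integrable_on {s..t}"
    and "\<bar>integral {s..t} (\<lambda>x. G x * x powr -e * cos (h * x + \<psi>))\<bar> \<le> 12 * C / h * s powr -e"
proof -
  have GC: "\<bar>G x\<bar> \<le> C" if "0 < x" "x < b" for x
    using G that by (auto simp: dyadically_bounded_variation_def)
  have C: "0 \<le> C" using GC[of s] ab by linarith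
  \<comment> \<open>dominates the increments of the product \<open>G x * x powr -e\<close>\<close>
  define w where "w y = s powr -e * W s y - C * y powr -e" for y
  have w: "\<bar>G y * y powr -e - G x * x powr -e\<bar> \<le> w y - w x" if "s \<le> x" "x \<le> y" "y \<le> t" for x y
  proof -
    have pw: "y powr -e \<le> x powr -e" "y powr -e \<le> s powr -e"
      using that ab \<open>0 < e\<close> by (auto intro!: powr_mono2')
    have W: "\<bar>G y - G x\<bar> \<le> W x y" "W s x + W x y \<le> W s y"
      using G that ab by (auto simp: dyadically_bounded_variation_def)
    have "\<bar>G y * y powr -e - G x * x powr -e\<bar> =
        \<bar>(G y - G x) * y powr -e + G x * (y powr -e - x powr -e)\<bar>"
      by (simp add: algebra_simps)
    also have "\<dots> \<le> \<bar>G y - G x\<bar> * y powr -e + \<bar>G x\<bar> * (x powr -e - y powr -e)"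
      using pw by (intro order_trans[OF abs_triangle_ineq]) (simp add: abs_mult)
    also have "\<dots> \<le> W x y * s powr -e + C * (x powr -e - y powr -e)"
      using pw W GC[of x] that ab by (intro add_mono mult_mono) auto
    \<comment> \<open>Superadditivity replaces \<open>W x y\<close> by an increment of
      \<open>W s\<close>.\<close>
    also have "\<dots> \<le> (W s y - W s x) * s powr -e + C * (x powr -e - y powr -e)"
      using W by (intro add_right_mono mult_right_mono) auto
    also have "\<dots> = w y - w x"
      by (simp add: w_def algebra_simps)
    finally show ?thesis .
  qed
  have ts: "t powr -e \<le> s powr -e"
    using ab \<open>0 < e\<close> by (auto intro!: powr_mono2')
  have 1: "\<bar>G s * s powr -e\<bar> \<le> C * s powr -e"
    using GC[of s] ab by (auto simp: abs_mult intro!: mult_right_mono)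
  have 2: "\<bar>G t * t powr -e\<bar> \<le> C * s powr -e"
    using GC[of t] ab ts C unfolding abs_mult by (intro mult_mono) auto
  have Wst: "W s t \<le> C"
    using G ab by (auto simp: dyadically_bounded_variation_def)
  \<comment> \<open>The degenerate interval gives the sign of \<open>W s s\<close>, which enters
    through \<open>w s\<close>.\<close>
  have "\<bar>G s - G s\<bar> \<le> W s s"
    using G ab unfolding dyadically_bounded_variation_def by (meson order.refl order.strict_trans1)
  then have "0 \<le> W s s" by simp
  with Wst have "s powr -e * W s t - s powr -e * W s s \<le> C * s powr -e - 0"
    by (intro diff_mono) (auto simp: mult.commute mult_right_mono)
  moreover have "C * s powr -e - C * t powr -e \<le> C * s powr -e"
    using C by simp
  ultimately have 3: "w t - w s \<le> 2 * C * s powr -e"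
    by (simp add: w_def)
  note * = bounded_variation_times_cos[where w = w and \<psi> = \<psi>, OF ab(2) \<open>0 < h\<close> w 1 2 3]
  show "(\<lambda>x. G x * x powr -e * cos (h * x + \<psi>)) integrable_on {s..t}"
    using *(1) .
  show "\<bar>integral {s..t} (\<lambda>x. G x * x powr -e * cos (h * x + \<psi>))\<bar> \<le> 12 * C / h * s powr -e"
    using *(2) by (simp add: algebra_simps)
qed

text \<open>Induction on the number of doublings from \<open>s\<close> to \<open>t\<close>, peeling
  off [s, 2s]. The block bounds form a geometric series with ratio 2^(-e), so the result depends
  neither on that number nor on \<open>t\<close>.\<close>

lemma dyadic_sum_bound:
  assumes G: "dyadically_bounded_variation G b W C" and "0 < e" "0 < h"
    and ab: "0 < s" "s \<le> t" "t < b"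
  shows "(\<lambda>x. G x * x powr -e * cos (h * x + \<psi>)) integrable_on {s..t} \<and>
    \<bar>integral {s..t} (\<lambda>x. G x * x powr -e * cos (h * x + \<psi>))\<bar> \<le> 12 * C / (1 - 2 powr -e) / h * s powr -e"
proof -
  let ?f = "\<lambda>x. G x * x powr -e * cos (h * x + \<psi>)"
  define q :: real where "q = 2 powr -e"
  have q: "0 < q" "q < 1" using \<open>0 < e\<close> by (auto simp: q_def powr_less_one)
  have "\<bar>G s\<bar> \<le> C" using G ab by (auto simp: dyadically_bounded_variation_def)
  then have C: "0 \<le> C" by linarith
  obtain n where n: "t \<le> 2 ^ n * s"
  proof -
    obtain n :: nat where "t / s < 2 ^ n" using real_arch_pow[of 2 "t / s"] by auto
    then show thesis using that[of n] ab by (simp add: field_simps)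
  qed
  have "?f integrable_on {s..t} \<and> \<bar>integral {s..t} ?f\<bar> \<le> 12 * C / (1 - q) / h * s powr -e"
    using ab n
  proof (induction n arbitrary: s)
    case 0
    then have "s = t" by simp
    then show ?case using C q \<open>0 < h\<close> integrable_on_refl[of ?f t] by auto
  next
    case (Suc n)
    have base: "12 * C / h * s powr -e \<le> 12 * C / (1 - q) / h * s powr -e"
    proof -
      have "12 * C / 1 \<le> 12 * C / (1 - q)"
        using C q by (intro divide_left_mono) auto
      then show ?thesis
        using \<open>0 < h\<close> by (intro mult_right_mono divide_right_mono) auto
    qed
    show ?case
    proof (cases "t \<le> 2 * s")
      case True
      then show ?thesis
        using dyadic_block_bound[OF G \<open>0 < e\<close> \<open>0 < h\<close> Suc.prems(1-3), of \<psi>] base by auto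
    next
      case False
      have A: "?f integrable_on {s..2 * s}" "\<bar>integral {s..2 * s} ?f\<bar> \<le> 12 * C / h * s powr -e"
        using dyadic_block_bound[OF G \<open>0 < e\<close> \<open>0 < h\<close> Suc.prems(1), of "2 * s" \<psi>] False Suc.prems by auto
      have B: "?f integrable_on {2 * s..t}"
        "\<bar>integral {2 * s..t} ?f\<bar> \<le> 12 * C / (1 - q) / h * (2 * s) powr -e"
        using Suc.IH[of "2 * s"] False Suc.prems by (auto simp: mult_ac)
      have int: "?f integrable_on {s..t}"
        using Henstock_Kurzweil_Integration.integrable_combine[OF _ _ A(1) B(1)] Suc.prems False by auto
      have "integral {s..t} ?f = integral {s..2 * s} ?f + integral {2 * s..t} ?f"
        using Henstock_Kurzweil_Integration.integral_combine[OF _ _ int, of "2 * s"] Suc.prems False by auto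
      then have "\<bar>integral {s..t} ?f\<bar> \<le> 12 * C / h * s powr -e + 12 * C / (1 - q) / h * (2 * s) powr -e"
        using A(2) B(2) by linarith
      also have "(2 * s) powr -e = q * s powr -e"
        using Suc.prems by (simp add: powr_mult q_def)
      \<comment> \<open>The induction closes because 1 + q / (1 - q) = 1 / (1 - q).\<close>
      also have "12 * C / h * s powr -e + 12 * C / (1 - q) / h * (q * s powr -e)
          = 12 * C / (1 - q) / h * s powr -e"
        using q \<open>0 < h\<close> by (simp add: field_simps)
      finally show ?thesis using int by blast
    qed
  qed
  then show ?thesis by (simp add: q_def)
qed

section \<open>The Fourier transform of the Gamma density\<close>

lemma
  fixes s :: real
  assumes "0 < s"
  shows set_integrable_Gamma_density: "set_integrable lborel {0<..} (\<lambda>x. x powr (s - 1) * exp (- x))"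
    and set_integral_Gamma_density: "(LINT x:{0<..}|lborel. x powr (s - 1) * exp (- x)) = Gamma s"
proof -
  \<comment> \<open>At t = 0 both sides vanish, as \<open>0 powr _\<close> is 0, so the closed and
    the open half-line give the same integrand.\<close>
  have eq: "indicator {0..} t * t powr (s - 1) / exp t = indicator {0<..} t * (t powr (s - 1) * exp (- t))" for t :: real
    by (auto simp: indicator_def exp_minus field_simps)
  have nn: "(\<integral>\<^sup>+t. ennreal (indicator {0<..} t * (t powr (s - 1) * exp (- t))) \<partial>lborel) = ennreal (Gamma s)"
    using Gamma_conv_nn_integral_real[OF assms] unfolding eq by simp
  have "has_bochner_integral lborel (\<lambda>t. indicator {0<..} t * (t powr (s - 1) * exp (- t))) (Gamma s)"
    using assms by (intro has_bochner_integral_nn_integral nn) (auto simp: Gamma_real_pos less_imp_le)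
  then show "set_integrable lborel {0<..} (\<lambda>x. x powr (s - 1) * exp (- x))"
    "(LINT x:{0<..}|lborel. x powr (s - 1) * exp (- x)) = Gamma s"
    by (simp_all add: set_integrable_def set_lebesgue_integral_def has_bochner_integral_iff)
qed

text \<open>Up to the factor \<open>Gamma s\<close>, the characteristic function of the Gamma
  distribution with shape s and rate 1.\<close>

definition Gamma_fourier :: "real \<Rightarrow> real \<Rightarrow> complex" where
  "Gamma_fourier s h =
     (LINT x:{0<..}|lborel. complex_of_real (x powr (s - 1) * exp (- x)) * iexp (h * x))"

lemma set_integrable_Gamma_fourier:
  assumes "0 < s"
  shows "set_integrable lborel {0<..} (\<lambda>x. complex_of_real (x powr (s - 1) * exp (- x)) * iexp (h * x))"
  by (rule set_integrable_bound[OF set_integrable_Gamma_density[OF assms]])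
     (auto simp: norm_mult set_borel_measurable_def)

lemma Gamma_fourier_0:
  assumes "0 < s"
  shows "Gamma_fourier s 0 = of_real (Gamma s)"
  using set_integral_Gamma_density[OF assms]
  by (simp add: Gamma_fourier_def set_integral_complex_of_real del: of_real_mult)

text \<open>The first-order Taylor remainder of \<open>iexp (k * x)\<close> is at most (k x)^2 / 2,
  and the factors x and x^2 raise the shape to s + 1 and s + 2. The quadratic error yields
  differentiation under the integral sign.\<close>

lemma Gamma_fourier_expansion:
  assumes s: "0 < s"
  shows "norm (Gamma_fourier s (h + k) - Gamma_fourier s h - of_real k * (\<i> * Gamma_fourier (s + 1) h))
    \<le> k\<^sup>2 / 2 * Gamma (s + 2)"
proof -
  let ?g = "\<lambda>s h x. complex_of_real (x powr (s - 1) * exp (- x)) * iexp (h * x)"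
  let ?u = "\<lambda>x. ?g s (h + k) x - ?g s h x - of_real k * (\<i> * ?g (s + 1) h x)"
  note int = set_integrable_Gamma_fourier[OF s] set_integrable_Gamma_fourier[of "s + 1"]
  have int3: "set_integrable lborel {0<..} (\<lambda>x. of_real k * (\<i> * ?g (s + 1) h x))"
    using int(2) s by (cases "k = 0") (simp add: set_integrable_def, intro set_integrable_mult_right, auto)
  have eq: "Gamma_fourier s (h + k) - Gamma_fourier s h - of_real k * (\<i> * Gamma_fourier (s + 1) h)
      = (LINT x:{0<..}|lborel. ?u x)"
    using set_integral_diff(2)[OF set_integral_diff(1)[OF int(1)[of "h + k"] int(1)[of h]] int3]
      set_integral_diff(2)[OF int(1)[of "h + k"] int(1)[of h]]
    unfolding Gamma_fourier_def by (simp only: set_integral_mult_right)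
  have intu: "set_integrable lborel {0<..} ?u"
    by (intro set_integral_diff(1) int(1) int3)
  have bound: "norm (?u x) \<le> k\<^sup>2 / 2 * (x powr (s + 2 - 1) * exp (- x))" if "x \<in> {0<..}" for x
  proof -
    have x: "0 < x" using that by simp
    have p: "x powr (s + 1 - 1) = x powr (s - 1) * x" "x powr (s + 2 - 1) = x powr (s - 1) * x\<^sup>2"
      using x by (simp_all add: powr_add powr_diff power2_eq_square powr_numeral)
    have "?u x = of_real (x powr (s - 1) * exp (- x)) * iexp (h * x) * (iexp (k * x) - (\<Sum>j\<le>1. (\<i> * (k * x)) ^ j / fact j))"
      unfolding p by (simp add: algebra_simps exp_add)
    also have "norm \<dots> = x powr (s - 1) * exp (- x) * cmod (iexp (k * x) - (\<Sum>j\<le>1. (\<i> * (k * x)) ^ j / fact j))"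
      by (simp add: norm_mult)
    also have "\<dots> \<le> x powr (s - 1) * exp (- x) * (\<bar>k * x\<bar> ^ Suc 1 / fact (Suc 1))"
      by (intro mult_left_mono iexp_approx1) auto
    also have "\<dots> = k\<^sup>2 / 2 * (x powr (s + 2 - 1) * exp (- x))"
      unfolding p by (simp add: power2_eq_square)
    finally show ?thesis .
  qed
  have int4: "set_integrable lborel {0<..} (\<lambda>x. k\<^sup>2 / 2 * (x powr (s + 2 - 1) * exp (- x)))"
    using s by (intro set_integrable_mult_right set_integrable_Gamma_density) auto
  have "norm (LINT x:{0<..}|lborel. ?u x) \<le> (LINT x:{0<..}|lborel. norm (?u x))"
    by (rule set_integral_norm_bound[OF intu])
  also have "\<dots> \<le> (LINT x:{0<..}|lborel. k\<^sup>2 / 2 * (x powr (s + 2 - 1) * exp (- x)))"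
    by (rule set_integral_mono[OF set_integrable_norm[OF intu] int4 bound])
  also have "\<dots> = k\<^sup>2 / 2 * Gamma (s + 2)"
    using set_integral_Gamma_density[of "s + 2"] s by simp
  finally show ?thesis unfolding eq .
qed

lemma has_vector_derivative_Gamma_fourier:
  assumes s: "0 < s"
  shows "(Gamma_fourier s has_vector_derivative \<i> * Gamma_fourier (s + 1) h) (at h)"
  unfolding has_vector_derivative_def has_derivative_at_alt
proof (intro conjI allI impI)
  show "bounded_linear (\<lambda>x. x *\<^sub>R (\<i> * Gamma_fourier (s + 1) h))"
    by (rule bounded_linear_scaleR_left)
  fix e :: real assume e: "0 < e"
  define G where "G = Gamma (s + 2)"
  have G: "0 < G" unfolding G_def using s by (intro Gamma_real_pos) auto
  show "\<exists>d>0. \<forall>y. norm (y - h) < d \<longrightarrow>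
      norm (Gamma_fourier s y - Gamma_fourier s h - (y - h) *\<^sub>R (\<i> * Gamma_fourier (s + 1) h)) \<le> e * norm (y - h)"
  proof (intro exI[of _ "e / G"] conjI allI impI)
    fix y :: real assume y: "norm (y - h) < e / G"
    have "norm (Gamma_fourier s y - Gamma_fourier s h - (y - h) *\<^sub>R (\<i> * Gamma_fourier (s + 1) h))
        \<le> (y - h)\<^sup>2 / 2 * G"
      using Gamma_fourier_expansion[OF s, of h "y - h"] by (simp add: scaleR_conv_of_real G_def)
    also have "\<dots> = (\<bar>y - h\<bar> * G) / 2 * \<bar>y - h\<bar>"
      by (simp add: power2_eq_square abs_mult_self_eq)
    also have "\<dots> \<le> e * \<bar>y - h\<bar>"
    proof (rule mult_right_mono)
      have "\<bar>y - h\<bar> * G < e" using y G by (simp add: field_simps)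
      then show "\<bar>y - h\<bar> * G / 2 \<le> e" using e by linarith
    qed auto
    finally show "norm (Gamma_fourier s y - Gamma_fourier s h - (y - h) *\<^sub>R (\<i> * Gamma_fourier (s + 1) h))
        \<le> e * norm (y - h)" by simp
  qed (use e G in auto)
qed

text \<open>Integration by parts: x^s exp(-x) exp(i h x) vanishes at both ends for s > 0, so its
  derivative integrates to 0. At h = 0 this is the recursion of the Gamma function.\<close>

lemma Gamma_fourier_plus1:
  assumes s: "0 < s"
  shows "of_real s * Gamma_fourier s h = (1 - \<i> * h) * Gamma_fourier (s + 1) h"
proof -
  let ?g = "\<lambda>s x. complex_of_real (x powr (s - 1) * exp (- x)) * iexp (h * x)"
  let ?F = "\<lambda>x. complex_of_real (x powr s * exp (- x)) * iexp (h * x)"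
  let ?f = "\<lambda>x. of_real s * ?g s x - (1 - \<i> * h) * ?g (s + 1) x"
  have nz: "1 - \<i> * h \<noteq> 0" by (auto simp: complex_eq_iff)
  have ints: "set_integrable lborel {0<..} (\<lambda>x. of_real s * ?g s x)"
    "set_integrable lborel {0<..} (\<lambda>x. (1 - \<i> * h) * ?g (s + 1) x)"
    using set_integrable_Gamma_fourier[of s h] set_integrable_Gamma_fourier[of "s + 1" h] s nz by auto
  have normF: "norm (?F x) = x powr s * exp (- x)" if "0 < x" for x
    by (simp add: norm_mult)
  have "(LBINT x=ereal 0..\<infinity>. ?f x) = 0 - 0"
  proof (rule interval_integral_FTC_integrable[where F = ?F])
    fix x assume x: "ereal 0 < ereal x"
    then have x: "0 < x" by simp
    have p: "x powr s = x powr (s - 1) * x"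
      using x by (simp add: powr_diff)
    show "(?F has_vector_derivative ?f x) (at x)"
      using x unfolding has_vector_derivative_complex_iff
      by (auto intro!: derivative_eq_intros simp: p field_simps Re_exp Im_exp)
    show "isCont ?f x"
      using x by (intro continuous_intros) auto
  next
    show "set_integrable lborel (einterval (ereal 0) \<infinity>) ?f"
      using ints by (auto simp del: zero_ereal_def)
  next
    have "((\<lambda>x::real. x powr s * exp (- x)) \<longlongrightarrow> 0) (at_right 0)"
      using s by real_asymp
    then have "(?F \<longlongrightarrow> 0) (at_right 0)"
      by (rule Lim_null_comparison[rotated])
         (auto intro!: eventually_mono[OF eventually_at_right_less[of 0]] simp only: normF)
    then show "((?F \<circ> real_of_ereal) \<longlongrightarrow> 0) (at_right (ereal 0))"
      by (simp add: ereal_tendsto_simps1 del: zero_ereal_def)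
  next
    have "((\<lambda>x::real. x powr s * exp (- x)) \<longlongrightarrow> 0) at_top"
      using s by real_asymp
    then have "(?F \<longlongrightarrow> 0) at_top"
      by (rule Lim_null_comparison[rotated]) 
         (auto intro!: eventually_mono[OF eventually_gt_at_top[of 0]] simp only: normF)
    then show "((?F \<circ> real_of_ereal) \<longlongrightarrow> 0) (at_left \<infinity>)"
      by (simp add: ereal_tendsto_simps1)
  qed auto
  then have "(LINT x:{0<..}|lborel. ?f x) = 0"
    by (simp only: interval_integral_to_infinity_eq diff_self)
  then show ?thesis
    using ints by (simp add: Gamma_fourier_def)
qed

text \<open>The derivative and the recursion give F' = i s F / (1 - i h), so (1 - i h)^s F is
  constant and can be evaluated at h = 0. The base has real part 1 and stays off the branch
  cut.\<close>

lemma Gamma_fourier_eq: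
  assumes s: "0 < s"
  shows "Gamma_fourier s h = of_real (Gamma s) * (1 - \<i> * h) powr (- of_real s)"
proof -
  define \<Phi> where "\<Phi> t = (1 - \<i> * of_real t) powr (of_real s) * Gamma_fourier s t" for t :: real
  have d0: "(\<Phi> has_vector_derivative 0) (at t)" for t
  proof -
    let ?z = "1 - \<i> * complex_of_real t"
    have nz: "?z \<noteq> 0" and pos: "?z \<notin> \<real>\<^sub>\<le>\<^sub>0"
      by (auto simp: complex_eq_iff complex_nonpos_Reals_iff)
    have "((\<lambda>z. (1 - \<i> * z) powr (of_real s)) has_field_derivative
        (of_real s * ?z powr (of_real s - 1) * (- \<i>))) (at (of_real t))"
      using pos by (auto intro!: derivative_eq_intros)
    then have "((\<lambda>t. (1 - \<i> * complex_of_real t) powr (of_real s)) has_vector_derivative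
        (of_real s * ?z powr (of_real s - 1) * (- \<i>))) (at t)"
      by (rule has_vector_derivative_real_field)
    then have deriv: "(\<Phi> has_vector_derivative
        (?z powr of_real s * (\<i> * Gamma_fourier (s + 1) t)
          + (of_real s * ?z powr (of_real s - 1) * (- \<i>)) * Gamma_fourier s t)) (at t)"
      unfolding \<Phi>_def by (intro has_vector_derivative_mult has_vector_derivative_Gamma_fourier s)
    have pz: "?z powr of_real s = ?z powr (of_real s - 1) * ?z"
      using nz by (simp add: powr_diff)
    have eq: "?z powr of_real s * (\<i> * Gamma_fourier (s + 1) t)
          + (of_real s * ?z powr (of_real s - 1) * (- \<i>)) * Gamma_fourier s t
        = \<i> * ?z powr (of_real s - 1) * (?z * Gamma_fourier (s + 1) t - of_real s * Gamma_fourier s t)"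
      unfolding pz by (simp add: algebra_simps)
    show ?thesis
      using deriv unfolding eq by (simp add: Gamma_fourier_plus1[OF s])
  qed
  have "\<Phi> h = \<Phi> 0"
    by (rule has_derivative_zero_unique[of UNIV])
       (use d0 in \<open>auto simp: has_vector_derivative_def\<close>)
  moreover have "1 - \<i> * h \<noteq> 0" by (auto simp: complex_eq_iff)
  ultimately show ?thesis
    using s by (simp add: \<Phi>_def Gamma_fourier_0 powr_minus field_simps)
qed

text \<open>h^s (1 - i h)^(-s) = (1/h - i)^(-s), which tends to (-i)^(-s) = exp(i s pi / 2).\<close>

lemma Gamma_fourier_limit:
  assumes s: "0 < s"
  shows "((\<lambda>h. of_real (h powr s) * Gamma_fourier s h) \<longlongrightarrow> of_real (Gamma s) * cis (s * pi / 2)) at_top"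
proof -
  have "((\<lambda>h::real. inverse h) \<longlongrightarrow> 0) at_top"
    by (rule tendsto_inverse_0_at_top[OF filterlim_ident])
  then have "((\<lambda>h. complex_of_real (inverse h) - \<i>) \<longlongrightarrow> of_real 0 - \<i>) at_top"
    by (intro tendsto_intros)
  then have "((\<lambda>h. (of_real (inverse h) - \<i>) powr (- of_real s)) \<longlongrightarrow> (of_real 0 - \<i>) powr (- complex_of_real s)) at_top"
    by (rule tendsto_powr_complex[rotated 1, OF _ tendsto_const]) (auto simp: complex_nonpos_Reals_iff)
  then have "((\<lambda>h. of_real (Gamma s) * (of_real (inverse h) - \<i>) powr (- of_real s)) \<longlongrightarrow>
      of_real (Gamma s) * (of_real 0 - \<i>) powr (- complex_of_real s)) at_top"
    by (rule tendsto_mult_left)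
  also have "(of_real 0 - \<i>) powr (- complex_of_real s) = cis (s * pi / 2)"
    by (simp add: powr_def cis_conv_exp mult_ac)
  finally show ?thesis
  proof (rule Lim_transform_eventually)
    show "\<forall>\<^sub>F h in at_top. of_real (Gamma s) * (of_real (inverse h) - \<i>) powr (- of_real s) =
        of_real (h powr s) * Gamma_fourier s h"
      using eventually_gt_at_top[of 0]
    proof eventually_elim
      case (elim h)
      have nz: "complex_of_real (inverse h) - \<i> \<noteq> 0" by (auto simp: complex_eq_iff)
      have "1 - \<i> * of_real h = of_real h * (of_real (inverse h) - \<i>)"
        using elim by (simp add: field_simps)
      \<comment> \<open>Extracting a positive real factor adds no multiple of 2 pi i to the
        logarithm.\<close>
      then have ln: "Ln (1 - \<i> * of_real h) = of_real (ln h) + Ln (of_real (inverse h) - \<i>)"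
        using Ln_times_of_real[OF elim nz] Ln_of_real[OF elim] by simp
      have "(1 - \<i> * of_real h) powr (- of_real s) =
          of_real h powr (- of_real s) * (of_real (inverse h) - \<i>) powr (- of_real s)"
        using elim nz by (simp add: powr_def ln Ln_of_real exp_add[symmetric] algebra_simps)
      also have "complex_of_real h powr (- of_real s) = of_real (h powr - s)"
        using elim by (simp add: powr_of_real flip: of_real_minus)
      finally show ?case
        using elim by (simp add: Gamma_fourier_eq[OF s] powr_minus)
    qed
  qed
qed

section \<open>Oscillatory integrals at a power singularity\<close>

text \<open>x^(-e) exp(-x) decreases, so the integral over [b, t] is bounded uniformly in t, and t
  may tend to infinity.\<close>

lemma damped_power_tail:
  fixes e h \<psi> :: real
  assumes "0 < e" "e < 1" "0 < b" "0 < h"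
  shows "\<bar>LINT x:{b..}|lborel. x powr -e * exp (- x) * cos (h * x + \<psi>)\<bar> \<le> 4 / h * b powr -e"
proof -
  let ?f = "\<lambda>x. x powr -e * exp (- x) * cos (h * x + \<psi>)"
  have "set_integrable lborel {0<..} (\<lambda>x. x powr -e * exp (- x))"
    using set_integrable_Gamma_density[of "1 - e"] assms by simp
  then have int0: "set_integrable lborel {0<..} ?f"
    by (rule set_integrable_bound)
       (auto simp: set_borel_measurable_def abs_mult intro!: AE_I2 mult_left_le)
  then have int: "set_integrable lborel {b..} ?f"
    by (rule set_integrable_subset) (use assms in auto)
  have "((\<lambda>t. LINT x:{b..t}|lborel. ?f x) \<longlongrightarrow> (LINT x:{b..}|lborel. ?f x)) at_top"
    by (rule tendsto_set_lebesgue_integral_at_top[OF _ int]) auto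
  then have lim: "((\<lambda>t. \<bar>LINT x:{b..t}|lborel. ?f x\<bar>) \<longlongrightarrow> \<bar>LINT x:{b..}|lborel. ?f x\<bar>) at_top"
    by (rule tendsto_rabs)
  have bound: "\<bar>LINT x:{b..t}|lborel. ?f x\<bar> \<le> 4 / h * b powr -e" if "b \<le> t" for t
  proof -
    \<comment> \<open>Negated because the bound is stated for increasing functions.\<close>
    let ?g = "\<lambda>x. - (x powr -e * exp (- x))"
    have antimono: "y powr -e * exp (- y) \<le> x powr -e * exp (- x)" if "b \<le> x" "x \<le> y" for x y
      using that assms by (intro mult_mono powr_mono2') auto
    then have g: "?g x \<le> ?g y" if "b \<le> x" "x \<le> y" "y \<le> t" for x y
      using that by simp
    have "set_integrable lborel {b..t} ?f"
      by (rule set_integrable_subset[OF int]) auto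
    then have "(LINT x:{b..t}|lborel. ?f x) = integral {b..t} ?f"
      by (rule set_borel_integral_eq_integral)
    also have "\<dots> = - integral {b..t} (\<lambda>x. ?g x * cos (h * x + \<psi>))"
      by simp
    finally have "\<bar>LINT x:{b..t}|lborel. ?f x\<bar> \<le> 2 / h * (\<bar>?g b\<bar> + \<bar>?g t\<bar>)"
      using monotone_times_cos(2)[where g = ?g and \<psi> = \<psi>, OF that \<open>0 < h\<close> g] by simp
    also have "\<dots> \<le> 2 / h * (b powr -e + b powr -e)"
    proof (intro mult_left_mono add_mono)
      show 1: "\<bar>?g b\<bar> \<le> b powr -e"
        using assms by (auto simp: abs_mult intro!: mult_left_le)
      show "\<bar>?g t\<bar> \<le> b powr -e"
        using 1 antimono[OF _ that] by (simp add: abs_mult)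
    qed (use assms in auto)
    finally show ?thesis by simp
  qed
  show ?thesis
    using eventually_mono[OF eventually_ge_at_top[of b] bound]
    by (intro tendsto_upperbound[OF lim]) auto
qed

text \<open>The integral over the half-line is known exactly; cutting it off at \<open>b\<close>
  costs O(1/h), which is O(h^(-e)) after scaling.\<close>

lemma damped_power_cos_limit:
  fixes e \<psi> :: real
  assumes e: "0 < e" "e < 1" and b: "0 < b"
  shows "((\<lambda>h. h powr (1 - e) * (LINT x:{0<..<b}|lborel. x powr -e * exp (- x) * cos (h * x + \<psi>)))
    \<longlongrightarrow> Gamma (1 - e) * cos ((1 - e) * pi / 2 + \<psi>)) at_top"
    and "set_integrable lborel {0<..<b} (\<lambda>x. x powr -e * exp (- x) * cos (h * x + \<psi>))"
proof -
  let ?f = "\<lambda>h x. x powr -e * exp (- x) * cos (h * x + \<psi>)"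
  have s: "0 < 1 - e" using e by simp
  have int1: "set_integrable lborel {0<..} (\<lambda>x. x powr -e * exp (- x))"
    using set_integrable_Gamma_density[OF s] by simp
  then have int0: "set_integrable lborel {0<..} (?f h)" for h
    by (rule set_integrable_bound)
       (auto simp: set_borel_measurable_def abs_mult intro!: AE_I2 mult_left_le)
  have int: "set_integrable lborel {0<..<b} (?f h)" "set_integrable lborel {b..} (?f h)" for h
    by (rule set_integrable_subset[OF int0]; use b in auto)+
  show "set_integrable lborel {0<..<b} (?f h)" by (rule int)
  \<comment> \<open>The phase becomes a constant factor \<open>cis \<psi>\<close> of the complex
    integral, whose real part is taken.\<close>
  have full: "(LINT x:{0<..}|lborel. ?f h x) = Re (cis \<psi> * Gamma_fourier (1 - e) h)" for h
  proof -
    let ?g = "\<lambda>x. cis \<psi> * (complex_of_real (x powr (1 - e - 1) * exp (- x)) * iexp (h * x))"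
    have "set_integrable lborel {0<..} ?g"
      by (intro set_integrable_mult_right set_integrable_Gamma_fourier s)
    then have "(LINT x:{0<..}|lborel. Re (?g x)) = Re (LINT x:{0<..}|lborel. ?g x)"
      unfolding set_integrable_def set_lebesgue_integral_def
      by (subst integral_Re[symmetric]) (auto simp only: scaleR_complex.sel real_scaleR_def)
    also have "(LINT x:{0<..}|lborel. ?g x) = cis \<psi> * Gamma_fourier (1 - e) h"
      by (simp only: Gamma_fourier_def set_integral_mult_right)
    also have "(\<lambda>x. Re (?g x)) = ?f h"
      by (auto simp: cos_add Re_exp Im_exp algebra_simps fun_eq_iff)
    finally show ?thesis .
  qed
  have "((\<lambda>h. Re (cis \<psi> * (of_real (h powr (1 - e)) * Gamma_fourier (1 - e) h)))
      \<longlongrightarrow> Re (cis \<psi> * (of_real (Gamma (1 - e)) * cis ((1 - e) * pi / 2)))) at_top"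
    by (intro tendsto_Re tendsto_mult_left Gamma_fourier_limit s)
  also have "(\<lambda>h. Re (cis \<psi> * (of_real (h powr (1 - e)) * Gamma_fourier (1 - e) h))) =
      (\<lambda>h. h powr (1 - e) * (LINT x:{0<..}|lborel. ?f h x))"
    unfolding full by (simp add: algebra_simps fun_eq_iff)
  also have "Re (cis \<psi> * (of_real (Gamma (1 - e)) * cis ((1 - e) * pi / 2))) =
      Gamma (1 - e) * cos ((1 - e) * pi / 2 + \<psi>)"
    by (simp add: cos_add algebra_simps)
  finally have lim1: "((\<lambda>h. h powr (1 - e) * (LINT x:{0<..}|lborel. ?f h x)) \<longlongrightarrow>
      Gamma (1 - e) * cos ((1 - e) * pi / 2 + \<psi>)) at_top" .
  have "((\<lambda>h::real. h powr (1 - e) * (4 / h * b powr -e)) \<longlongrightarrow> 0) at_top"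
    using e by real_asymp
  then have lim2: "((\<lambda>h. h powr (1 - e) * (LINT x:{b..}|lborel. ?f h x)) \<longlongrightarrow> 0) at_top"
  proof (rule Lim_null_comparison[rotated])
    show "\<forall>\<^sub>F h in at_top. norm (h powr (1 - e) * (LINT x:{b..}|lborel. ?f h x)) \<le>
        h powr (1 - e) * (4 / h * b powr -e)"
      using eventually_gt_at_top[of 0]
      by eventually_elim (use damped_power_tail[OF e b] in \<open>auto simp: abs_mult simp del: times_divide_eq_left intro!: mult_left_mono\<close>)
  qed
  have un: "(LINT x:{0<..}|lborel. ?f h x) = (LINT x:{0<..<b}|lborel. ?f h x) + (LINT x:{b..}|lborel. ?f h x)" for h
  proof -
    have "{0<..} = {0<..<b} \<union> {b..}" using b by auto
    moreover have "{0<..<b} \<inter> {b..} = {}" by auto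
    ultimately show ?thesis using set_integral_Un[OF _ int[of h]] by simp
  qed
  have "h powr (1 - e) * (LINT x:{0<..<b}|lborel. ?f h x) =
      h powr (1 - e) * (LINT x:{0<..}|lborel. ?f h x) - h powr (1 - e) * (LINT x:{b..}|lborel. ?f h x)" for h
    by (simp only: un ring_distribs add_diff_cancel_right')
  then show "((\<lambda>h. h powr (1 - e) * (LINT x:{0<..<b}|lborel. ?f h x))
    \<longlongrightarrow> Gamma (1 - e) * cos ((1 - e) * pi / 2 + \<psi>)) at_top"
    using tendsto_diff[OF lim1 lim2] by simp
qed

text \<open>The integral is split at s = N/h; scaled by h^(1 - e), the two parts are at most \<eta>
  N^(1 - e) / (1 - e) and K N^(-e). Integrability up to \<open>b\<close> is a hypothesis, to be
  supplied by the spectral density.\<close>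

lemma oscillatory_integral_null:
  assumes G: "dyadically_bounded_variation G b W C" and e: "0 < e" "e < 1" and b: "0 < b"
    and G0: "(G \<longlongrightarrow> 0) (at_right 0)"
    and int: "\<And>h. (\<lambda>x. G x * x powr -e * cos (h * x + \<psi>)) integrable_on {0..b}"
  shows "((\<lambda>h. h powr (1 - e) * integral {0..b} (\<lambda>x. G x * x powr -e * cos (h * x + \<psi>))) \<longlongrightarrow> 0) at_top"
proof -
  let ?f = "\<lambda>h x. G x * x powr -e * cos (h * x + \<psi>)"
  define K where "K = 12 * C / (1 - 2 powr -e)"
  have "\<bar>G (b / 2)\<bar> \<le> C" using G b by (auto simp: dyadically_bounded_variation_def)
  then have C: "0 \<le> C" by linarith
  have "(2::real) powr -e < 1" using e by (simp add: powr_less_one)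
  then have K: "0 \<le> K" using C by (simp add: K_def)
  \<comment> \<open>The dyadic bound stops short of \<open>b\<close>, where nothing is known about
    \<open>G\<close>; continuity of the indefinite integral extends it.\<close>
  have tail: "\<bar>integral {s..b} (?f h)\<bar> \<le> K / h * s powr -e" if "0 < s" "s < b" "0 < h" for s h
  proof -
    have "(?f h) integrable_on {s..b}"
      using integrable_subinterval_real[OF int[of h]] that by auto
    then have "continuous_on {s..b} (\<lambda>t. integral {s..t} (?f h))"
      by (rule indefinite_integral_continuous_1)
    then have "((\<lambda>t. integral {s..t} (?f h)) \<longlongrightarrow> integral {s..b} (?f h)) (at_left b)"
      using that by (intro continuous_on_Icc_at_leftD)
    then have lim: "((\<lambda>t. \<bar>integral {s..t} (?f h)\<bar>) \<longlongrightarrow> \<bar>integral {s..b} (?f h)\<bar>) (at_left b)"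
      by (rule tendsto_rabs)
    have "\<forall>\<^sub>F t in at_left b. t \<in> {s<..<b}"
      using that by (intro eventually_at_left_real)
    then have "\<forall>\<^sub>F t in at_left b. \<bar>integral {s..t} (?f h)\<bar> \<le> K / h * s powr -e"
      by eventually_elim (use dyadic_sum_bound[OF G e(1) that(3,1)] in \<open>auto simp: K_def\<close>)
    then show ?thesis
      by (rule tendsto_upperbound[OF lim]) auto
  qed
  \<comment> \<open>No oscillation is used here: x^(-e) is integrable at 0 because e < 1.\<close>
  have near: "\<bar>integral {0..s} (?f h)\<bar> \<le> \<eta> * s powr (1 - e) / (1 - e)"
    if "0 < s" "s < b" "0 \<le> \<eta>" "\<And>x. 0 < x \<Longrightarrow> x \<le> s \<Longrightarrow> \<bar>G x\<bar> \<le> \<eta>" for s h \<eta>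
  proof -
    have p: "((\<lambda>x. \<eta> * x powr -e) has_integral \<eta> * (s powr (-e + 1) / (-e + 1))) {0..s}"
      using that e by (intro has_integral_mult_right has_integral_powr_from_0) auto
    have "norm (integral {0..s} (?f h)) \<le> integral {0..s} (\<lambda>x. \<eta> * x powr -e)"
    proof (rule integral_norm_bound_integral)
      show "?f h integrable_on {0..s}"
        using integrable_subinterval_real[OF int[of h]] that by auto
      show "(\<lambda>x. \<eta> * x powr -e) integrable_on {0..s}" using p by blast
      fix x assume "x \<in> {0..s}"
      \<comment> \<open>At x = 0 both sides are 0, since \<open>0 powr -e\<close> is 0.\<close>
      then consider "x = 0" | "0 < x" "x \<le> s" by force
      then show "norm (?f h x) \<le> \<eta> * x powr -e"
      proof cases
        case 2
        then have "\<bar>G x\<bar> * x powr -e * \<bar>cos (h * x + \<psi>)\<bar> \<le> \<eta> * x powr -e * 1"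
          using that by (intro mult_mono) auto
        then show ?thesis by (simp add: abs_mult)
      qed simp
    qed
    then show ?thesis using integral_unique[OF p] by simp
  qed
  show ?thesis
    unfolding tendsto_iff dist_real_def
  proof (intro allI impI)
    fix r :: real assume r: "0 < r"
    have "((\<lambda>N::real. K * N powr -e) \<longlongrightarrow> K * 0) at_top"
      using e by (intro tendsto_mult_left tendsto_neg_powr filterlim_ident) auto
    then have "\<forall>\<^sub>F N in at_top. K * N powr -e < r / 2"
      using r by (intro order_tendstoD) auto
    then have "\<forall>\<^sub>F N in at_top. K * N powr -e < r / 2 \<and> 0 < N"
      using eventually_gt_at_top by (rule eventually_conj)
    then obtain N where N: "K * N powr -e < r / 2" "0 < N"
      by (rule eventually_happens'[OF trivial_limit_at_top_linorder, THEN exE]) blast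
    \<comment> \<open>Chosen so that the part near 0 contributes exactly r/2.\<close>
    define \<eta> where "\<eta> = r * (1 - e) / (2 * N powr (1 - e))"
    have \<eta>: "0 < \<eta>" using r e N by (simp add: \<eta>_def)
    have "\<forall>\<^sub>F x in at_right 0. \<bar>G x\<bar> < \<eta>"
      using order_tendstoD(2)[OF tendsto_rabs[OF G0], of \<eta>] \<eta> by simp
    then obtain \<rho> where \<rho>: "0 < \<rho>" "\<And>x. 0 < x \<Longrightarrow> x < \<rho> \<Longrightarrow> \<bar>G x\<bar> < \<eta>"
      unfolding eventually_at_right_field by auto
    show "\<forall>\<^sub>F h in at_top. \<bar>h powr (1 - e) * integral {0..b} (?f h) - 0\<bar> < r"
      \<comment> \<open>Ensures that the splitting point N/h lies below both \<open>b\<close> and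
        \<rho>.\<close>
      using eventually_gt_at_top[of "N / min b \<rho>"] eventually_gt_at_top[of 0]
    proof eventually_elim
      case (elim h)
      define s where "s = N / h"
      have "0 < min b \<rho>" using b \<rho> by simp
      then have "N < h * min b \<rho>" using elim(1) by (simp only: pos_divide_less_eq)
      then have "s < min b \<rho>" using elim(2) by (simp only: s_def pos_divide_less_eq mult.commute)
      moreover have "0 < s" using elim N by (simp add: s_def)
      ultimately have s: "0 < s" "s < b" "s < \<rho>" by auto
      have "integral {0..b} (?f h) = integral {0..s} (?f h) + integral {s..b} (?f h)"
        using s int[of h] by (intro Henstock_Kurzweil_Integration.integral_combine[symmetric]) auto
      then have "\<bar>integral {0..b} (?f h)\<bar> \<le> \<eta> * s powr (1 - e) / (1 - e) + K / h * s powr -e"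
        using near[OF s(1,2), of \<eta> h] tail[OF s(1,2) elim(2)] \<eta> \<rho>(2) s by force
      then have "h powr (1 - e) * \<bar>integral {0..b} (?f h)\<bar> \<le>
          h powr (1 - e) * (\<eta> * s powr (1 - e) / (1 - e) + K / h * s powr -e)"
        by (intro mult_left_mono) auto
      also have "\<dots> = \<eta> * (h * s) powr (1 - e) / (1 - e) + K * (h * s) powr -e"
      proof -
        have "(h * s) powr (1 - e) = h powr (1 - e) * s powr (1 - e)"
          using elim s by (simp add: powr_mult)
        moreover have "(h * s) powr -e = h powr (1 - e) / h * s powr -e"
          using elim s by (simp add: powr_mult powr_diff powr_minus field_simps)
        ultimately show ?thesis by (simp add: algebra_simps)
      qed
      also have "h * s = N" using elim by (simp add: s_def)
      also have "\<eta> * N powr (1 - e) / (1 - e) = r / 2"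
        using N e by (simp add: \<eta>_def field_simps)
      finally show ?case using N by (simp add: abs_mult)
    qed
  qed
qed

text \<open>exp(-x) is monotone, so its variation is the difference of its end values: additive, and
  at most 1 on the positive half-line.\<close>

lemma dyadically_bounded_variation_diff_exp:
  assumes "dyadically_bounded_variation G b W C"
  shows "dyadically_bounded_variation (\<lambda>x. G x - c * exp (- x)) b
    (\<lambda>x y. W x y + \<bar>c\<bar> * (exp (- x) - exp (- y))) (C + \<bar>c\<bar>)"
proof -
  have 1: "\<bar>c * exp (- x)\<bar> \<le> \<bar>c\<bar>" if "0 < x" for x :: real
    using that by (auto simp: abs_mult intro!: mult_left_le)
  have 2: "\<bar>c * exp (- y) - c * exp (- x)\<bar> \<le> \<bar>c\<bar> * (exp (- x) - exp (- y))" if "x \<le> y" for x y :: real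
    using that by (simp add: abs_mult flip: right_diff_distrib)
  have 3: "\<bar>c\<bar> * (exp (- x) - exp (- y)) \<le> \<bar>c\<bar>" if "0 < x" for x y :: real
  proof -
    have "exp (- x) \<le> 1" "0 < exp (- y)" using that by auto
    then have "exp (- x) - exp (- y) \<le> 1" by linarith
    then show ?thesis by (simp add: mult_left_le)
  qed
  show ?thesis
    unfolding dyadically_bounded_variation_def
  proof (intro conjI ballI allI impI)
    fix x assume x: "x \<in> {0<..<b}"
    have "\<bar>G x\<bar> \<le> C" using assms x by (auto simp: dyadically_bounded_variation_def)
    then show "\<bar>G x - c * exp (- x)\<bar> \<le> C + \<bar>c\<bar>" using 1[of x] x by auto
  next
    fix x y :: real assume xy: "0 < x" "x \<le> y" "y < b"
    have "\<bar>G y - G x\<bar> \<le> W x y" using assms xy by (auto simp: dyadically_bounded_variation_def)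
    then show "\<bar>G y - c * exp (- y) - (G x - c * exp (- x))\<bar> \<le> W x y + \<bar>c\<bar> * (exp (- x) - exp (- y))"
      using 2[of x y] xy by linarith
  next
    fix x y z :: real assume xy: "0 < x" "x \<le> y" "y \<le> z" "z < b"
    have "W x y + W y z \<le> W x z" using assms xy by (auto simp: dyadically_bounded_variation_def)
    then show "W x y + \<bar>c\<bar> * (exp (- x) - exp (- y)) + (W y z + \<bar>c\<bar> * (exp (- y) - exp (- z)))
        \<le> W x z + \<bar>c\<bar> * (exp (- x) - exp (- z))"
      by (simp add: algebra_simps)
  next
    fix x y :: real assume xy: "0 < x" "x \<le> y" "y < b" "y \<le> 2 * x"
    have "W x y \<le> C" using assms xy by (auto simp: dyadically_bounded_variation_def)
    then show "W x y + \<bar>c\<bar> * (exp (- x) - exp (- y)) \<le> C + \<bar>c\<bar>" using 3[of x y] xy by linarith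
  qed
qed

lemma oscillatory_integral_limit:
  assumes G: "dyadically_bounded_variation G b W C" and e: "0 < e" "e < 1" and b: "0 < b"
    and Gc: "(G \<longlongrightarrow> c) (at_right 0)"
    and int: "\<And>h. (\<lambda>x. G x * x powr -e * cos (h * x + \<psi>)) integrable_on {0..b}"
  shows "((\<lambda>h. h powr (1 - e) * integral {0..b} (\<lambda>x. G x * x powr -e * cos (h * x + \<psi>)))
    \<longlongrightarrow> c * Gamma (1 - e) * cos ((1 - e) * pi / 2 + \<psi>)) at_top"
proof -
  let ?D = "\<lambda>h x. x powr -e * exp (- x) * cos (h * x + \<psi>)"
  let ?G = "\<lambda>x. G x - c * exp (- x)"
  have D: "?D h integrable_on {0..b}" "(LINT x:{0<..<b}|lborel. ?D h x) = integral {0..b} (?D h)" for h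
    using set_borel_integral_eq_integral[OF damped_power_cos_limit(2)[OF e b, of h \<psi>]]
    by (simp_all add: integrable_on_Icc_iff_Ioo integral_open_interval_real)
  have eq: "?G x * x powr -e * cos (h * x + \<psi>) = G x * x powr -e * cos (h * x + \<psi>) - c * ?D h x" for h x
    by (simp add: algebra_simps)
  have intG: "(\<lambda>x. ?G x * x powr -e * cos (h * x + \<psi>)) integrable_on {0..b}" for h
    unfolding eq by (intro integrable_diff int integrable_on_mult_right D)
  have "((\<lambda>x. c * exp (- x)) \<longlongrightarrow> c * exp (- 0)) (at_right (0::real))"
    by (intro tendsto_intros)
  then have "(?G \<longlongrightarrow> c - c * exp (- 0)) (at_right 0)"
    by (intro tendsto_diff Gc)
  then have "(?G \<longlongrightarrow> 0) (at_right 0)" by simp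
  then have lim0: "((\<lambda>h. h powr (1 - e) * integral {0..b} (\<lambda>x. ?G x * x powr -e * cos (h * x + \<psi>))) \<longlongrightarrow> 0) at_top"
    by (intro oscillatory_integral_null[OF dyadically_bounded_variation_diff_exp[OF G]] e b intG)
  have lim1: "((\<lambda>h. c * (h powr (1 - e) * integral {0..b} (?D h))) \<longlongrightarrow>
      c * (Gamma (1 - e) * cos ((1 - e) * pi / 2 + \<psi>))) at_top"
    using tendsto_mult_left[OF damped_power_cos_limit(1)[OF e b, of \<psi>], of c] unfolding D(2) .
  have split: "integral {0..b} (\<lambda>x. ?G x * x powr -e * cos (h * x + \<psi>)) + c * integral {0..b} (?D h) =
      integral {0..b} (\<lambda>x. G x * x powr -e * cos (h * x + \<psi>))" for h
    unfolding eq using int[of h] D(1)[of h]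
    by (subst integral_diff) (auto intro: integrable_on_mult_right)
  have "h powr (1 - e) * integral {0..b} (\<lambda>x. ?G x * x powr -e * cos (h * x + \<psi>)) +
      c * (h powr (1 - e) * integral {0..b} (?D h)) =
      h powr (1 - e) * integral {0..b} (\<lambda>x. G x * x powr -e * cos (h * x + \<psi>))" for h
    unfolding split[symmetric] by (simp only: ring_distribs mult.left_commute)
  then show ?thesis
    using tendsto_add[OF lim0 lim1] by (simp only: add_0 mult.assoc)
qed

section \<open>Total variation and quasi-monotone functions\<close>

lemma abs_diff_le_total_variation:
  assumes "bounded_variation_on L s t" "s \<le> t"
  shows "\<bar>L t - L s\<bar> \<le> total_variation L s t"
  unfolding total_variation_def
proof (rule cSup_upper)
  have "{{s..t}} division_of {s..t}"
    using division_of_self[of s t] assms by simp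
  moreover have "\<bar>L t - L s\<bar> = (\<Sum>K\<in>{{s..t}}. \<bar>L (Sup K) - L (Inf K)\<bar>)"
    using assms by simp
  ultimately show "\<bar>L t - L s\<bar> \<in> variation_sums L s t"
    unfolding variation_sums_def by blast
  show "bdd_above (variation_sums L s t)"
    using assms by (simp add: bounded_variation_on_def)
qed

lemma variation_sums_nonempty:
  assumes "s \<le> t"
  shows "variation_sums L s t \<noteq> {}"
proof -
  have "{{s..t}} division_of {s..t}"
    using division_of_self[of s t] assms by simp
  then have "(\<Sum>K\<in>{{s..t}}. \<bar>L (Sup K) - L (Inf K)\<bar>) \<in> variation_sums L s t"
    unfolding variation_sums_def by blast
  then show ?thesis by blast
qed

text \<open>Divisions of the two intervals are glued; the suprema over them are then taken one after
  the other.\<close>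

lemma total_variation_superadditive:
  assumes st: "s \<le> t" "t \<le> u" and bv: "bounded_variation_on L s u"
  shows "total_variation L s t + total_variation L t u \<le> total_variation L s u"
proof -
  let ?S = "\<lambda>D. \<Sum>K\<in>D. \<bar>L (Sup K) - L (Inf K)\<bar>"
  have sums: "?S D + ?S E \<le> total_variation L s u"
    if D: "D division_of {s..t}" and E: "E division_of {t..u}" for D E
  proof -
    have "{s..t} \<union> {t..u} = {s..u}" using st by auto
    moreover have "(D \<union> E) division_of ({s..t} \<union> {t..u})"
      using D E by (rule division_disjoint_union) auto
    ultimately have DE: "(D \<union> E) division_of {s..u}" by simp
    have fin: "finite D" "finite E" using D E by (auto intro: division_of_finite)
    \<comment> \<open>The degenerate cell {t} may belong to both divisions, so the union need not be
      disjoint.\<close>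
    have "?S (D \<inter> E) = 0"
    proof (rule sum.neutral, intro ballI)
      fix K assume "K \<in> D \<inter> E"
      then have "K \<subseteq> {s..t}" "K \<subseteq> {t..u}" "K \<noteq> {}"
        using division_ofD(2,3)[OF D] division_ofD(2,3)[OF E] by auto
      then have "K = {t}" by fastforce
      then show "\<bar>L (Sup K) - L (Inf K)\<bar> = 0" by simp
    qed
    then have "?S D + ?S E = ?S (D \<union> E)"
      using sum.union_inter[OF fin, of "\<lambda>K. \<bar>L (Sup K) - L (Inf K)\<bar>"] by simp
    also have "\<dots> \<le> total_variation L s u"
      unfolding total_variation_def
    proof (rule cSup_upper)
      show "?S (D \<union> E) \<in> variation_sums L s u"
        using DE unfolding variation_sums_def by blast
      show "bdd_above (variation_sums L s u)" using bv by (simp add: bounded_variation_on_def)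
    qed
    finally show ?thesis .
  qed
  have 1: "?S D \<le> total_variation L s u - total_variation L t u" if D: "D division_of {s..t}" for D
  proof -
    have "total_variation L t u \<le> total_variation L s u - ?S D"
      unfolding total_variation_def[of L t u]
      using sums[OF D] variation_sums_nonempty[OF st(2), of L]
      by (intro cSup_least) (fastforce simp: variation_sums_def)+
    then show ?thesis by simp
  qed
  have "total_variation L s t \<le> total_variation L s u - total_variation L t u"
    unfolding total_variation_def[of L s t]
    using 1 variation_sums_nonempty[OF st(1), of L]
    by (intro cSup_least) (auto simp: variation_sums_def)
  then show ?thesis by simp
qed

text \<open>The weight is taken at the tag, which in a cell straddling m may lie left of m; hence
  m/2. With mesh at most m/2, every cell reaching beyond m has its tag at m/2 or later.\<close>

lemma has_RS_integral_powr_lower_bound: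
  assumes I: "has_RS_integral (\<lambda>u. u powr \<delta>) v s t I" and "0 < \<delta>" and st: "0 < s" "s \<le> m" "m \<le> t"
    and v: "\<And>x y. s \<le> x \<Longrightarrow> x \<le> y \<Longrightarrow> y \<le> t \<Longrightarrow> v x \<le> v y"
  shows "(m / 2) powr \<delta> * (v t - v m) \<le> I"
proof (rule field_le_epsilon)
  fix e :: real assume "0 < e"
  note RS = I[unfolded has_RS_integral_def, rule_format, OF this]
  obtain r where r: "0 < r" and rp: "\<forall>p. p tagged_division_of {s..t} \<and> (\<lambda>x. ball x r) fine p \<longrightarrow>
      \<bar>(\<Sum>(x, K)\<in>p. x powr \<delta> * (v (Sup K) - v (Inf K))) - I\<bar> < e"
    using RS by (elim exE conjE)
  define q where "q = min r (m / 2)"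
  have q: "0 < q" "q \<le> r" "q \<le> m / 2" using r st by (auto simp: q_def)
  have "gauge (\<lambda>x::real. ball x q)" using q by (intro gauge_ball) auto
  then obtain p where p: "p tagged_division_of {s..t}" and fine: "(\<lambda>x. ball x q) fine p"
    by (rule fine_division_exists_real)
  have "ball x q \<subseteq> ball x r" for x
    using q by (simp add: subset_ball)
  then have fine': "(\<lambda>x. ball x r) fine p"
    using fine unfolding fine_def by fastforce
  then have sumI: "(\<Sum>(x, K)\<in>p. x powr \<delta> * (v (Sup K) - v (Inf K))) < I + e"
    using rp[rule_format, OF conjI[OF p fine']] by linarith
  \<comment> \<open>telescoping \<open>F\<close> instead of \<open>v\<close> discards the cells left of \<open>m\<close>, so no division has to be split at \<open>m\<close>\<close>
  define F where "F u = v (max m u)" for u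
  have "(m / 2) powr \<delta> * (v t - v m) = (m / 2) powr \<delta> * (\<Sum>(x, K)\<in>p. F (Sup K) - F (Inf K))"
    using additive_tagged_division_1[OF _ p, of F] st by (simp add: F_def max_def)
  also have "\<dots> = (\<Sum>(x, K)\<in>p. (m / 2) powr \<delta> * (F (Sup K) - F (Inf K)))"
    by (simp add: sum_distrib_left case_prod_unfold)
  also have "\<dots> \<le> (\<Sum>(x, K)\<in>p. x powr \<delta> * (v (Sup K) - v (Inf K)))"
  proof (rule sum_mono, clarify)
    fix x K assume xK: "(x, K) \<in> p"
    obtain a b where K: "K = {a..b}" using tagged_division_ofD(4)[OF p xK] by auto
    have x: "x \<in> K" "K \<subseteq> {s..t}" using tagged_division_ofD(2,3)[OF p xK] by auto
    have Kq: "K \<subseteq> ball x q" using fine xK unfolding fine_def by auto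
    have ab: "a \<le> x" "x \<le> b" "s \<le> a" "b \<le> t" using x K by auto
    have vab: "v a \<le> v b" using v[of a b] ab by simp
    have "(m / 2) powr \<delta> * (F b - F a) \<le> x powr \<delta> * (v b - v a)"
    proof (cases "b \<le> m")
      case True
      then have "max m b = m" "max m a = m" using ab by auto
      then show ?thesis using vab by (simp add: F_def)
    next
      case False
      have "b \<in> K" using K ab by simp
      then have "b \<in> ball x q" using Kq by blast
      then have "m / 2 \<le> x" using False q by (auto simp: dist_real_def)
      then have 1: "(m / 2) powr \<delta> \<le> x powr \<delta>"
        using st \<open>0 < \<delta>\<close> by (intro powr_mono2) auto
      \<comment> \<open>Clipping at m can only shrink an increment of the increasing
        \<open>v\<close>.\<close>
      have 2: "F b - F a \<le> v b - v a"
        using False v[of a m] ab st by (auto simp: F_def max_def)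
      have "(m / 2) powr \<delta> * (F b - F a) \<le> (m / 2) powr \<delta> * (v b - v a)"
        using 2 by (intro mult_left_mono) auto
      also have "\<dots> \<le> x powr \<delta> * (v b - v a)"
        using 1 vab by (intro mult_right_mono) auto
      finally show ?thesis .
    qed
    then show "(m / 2) powr \<delta> * (F (Sup K) - F (Inf K)) \<le> x powr \<delta> * (v (Sup K) - v (Inf K))"
      using ab K by simp
  qed
  finally show "(m / 2) powr \<delta> * (v t - v m) \<le> I + e" using sumI by linarith
qed

text \<open>For s near a, superadditivity replaces the increment of the variation measured from s by
  the variation over [m, x]. This no longer involves s, so s may tend to a.\<close>

lemma has_variation_integral_powr_lower_bound:
  assumes I: "has_variation_integral (\<lambda>u. u powr \<delta>) L a x I" and "0 < \<delta>" and a: "0 < a" "a < m" "m \<le> x"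
    and bv: "\<And>s t. a < s \<Longrightarrow> s \<le> t \<Longrightarrow> bounded_variation_on L s t"
  shows "(m / 2) powr \<delta> * total_variation L m x \<le> I"
proof -
  obtain G where G: "\<And>s. a < s \<Longrightarrow> s \<le> x \<Longrightarrow> has_RS_integral (\<lambda>u. u powr \<delta>) (total_variation L s) s x (G s)"
    and lim: "(G \<longlongrightarrow> I) (at_right a)"
    using I unfolding has_variation_integral_def by blast
  have "\<forall>\<^sub>F s in at_right a. s \<in> {a<..<m}"
    using a by (intro eventually_at_right_real)
  then have "\<forall>\<^sub>F s in at_right a. (m / 2) powr \<delta> * total_variation L m x \<le> G s"
  proof eventually_elim
    case (elim s)
    have super: "total_variation L s y + total_variation L y z \<le> total_variation L s z"
      if "s \<le> y" "y \<le> z" for y z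
      using that elim by (intro total_variation_superadditive bv) auto
    have "total_variation L s y \<le> total_variation L s z" if "s \<le> y" "y \<le> z" for y z
      using super[OF that] abs_diff_le_total_variation[of L y z] bv[of y z] that elim by auto
    then have "(m / 2) powr \<delta> * (total_variation L s x - total_variation L s m) \<le> G s"
      using elim a \<open>0 < \<delta>\<close> by (intro has_RS_integral_powr_lower_bound[OF G]) auto
    moreover have "(m / 2) powr \<delta> * total_variation L m x \<le>
        (m / 2) powr \<delta> * (total_variation L s x - total_variation L s m)"
      using super[of m x] elim a by (intro mult_left_mono) auto
    ultimately show ?case by linarith
  qed
  then show ?thesis
    by (rule tendsto_lowerbound[OF lim]) auto
qed

text \<open>Inversion maps [x, y] to [1/y, 1/x] and preserves ratios. Far out, \<open>L\<close> is
  bounded, so (ii) gives J(x) = O(x^\<delta>), comparable to (m/2)^\<delta> on a block [m, x]; up to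
  \<open>x0\<close>, the finite value \<open>J x0\<close> controls all the variation.\<close>

lemma quasi_monotone_imp_dyadically_bounded_variation:
  assumes L: "quasi_monotone_slowly_varying a L" and a: "0 < a" and lim: "(L \<longlongrightarrow> c) at_top"
  shows "\<exists>C. dyadically_bounded_variation (\<lambda>x. L (1 / x)) (1 / a) (\<lambda>x y. total_variation L (1 / y) (1 / x)) C"
proof -
  have bv: "bounded_variation_on L s t" if "a < s" "s \<le> t" for s t
    using L that by (auto simp: quasi_monotone_slowly_varying_def)
  obtain \<delta> J where \<delta>: "0 < \<delta>" and J: "\<And>x. a < x \<Longrightarrow> has_variation_integral (\<lambda>u. u powr \<delta>) L a x (J x)"
    and JO: "J \<in> O[at_top](\<lambda>x. x powr \<delta> * L x)"
    using L unfolding quasi_monotone_slowly_varying_def by blast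
  obtain K where K: "0 < K" "\<forall>\<^sub>F x in at_top. norm (J x) \<le> K * norm (x powr \<delta> * L x)"
    using JO by (elim landau_o.bigE)
  define M where "M = \<bar>c\<bar> + 1"
  have M: "0 < M" by (simp add: M_def)
  have "\<forall>\<^sub>F x in at_top. \<bar>L x\<bar> < M"
    using tendsto_rabs[OF lim] by (rule order_tendstoD) (simp add: M_def)
  with K(2) have "\<forall>\<^sub>F x in at_top. \<bar>J x\<bar> \<le> K * \<bar>x powr \<delta> * L x\<bar> \<and> \<bar>L x\<bar> < M"
    by eventually_elim auto
  then obtain x1 where x1: "\<And>x. x1 \<le> x \<Longrightarrow> \<bar>J x\<bar> \<le> K * \<bar>x powr \<delta> * L x\<bar> \<and> \<bar>L x\<bar> < M"
    unfolding eventually_at_top_linorder by blast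
  define x0 where "x0 = max x1 (a + 1)"
  have x0: "a < x0" and far: "\<And>x. x0 \<le> x \<Longrightarrow> \<bar>J x\<bar> \<le> K * \<bar>x powr \<delta> * L x\<bar> \<and> \<bar>L x\<bar> < M"
    using x1 by (auto simp: x0_def)
  have super: "total_variation L s t + total_variation L t u \<le> total_variation L s u" if "a < s" "s \<le> t" "t \<le> u" for s t u
    using that by (intro total_variation_superadditive bv) auto
  have var: "\<bar>L t - L s\<bar> \<le> total_variation L s t" if "a < s" "s \<le> t" for s t
    using that by (intro abs_diff_le_total_variation bv)
  have lower: "(m / 2) powr \<delta> * total_variation L m x \<le> J x" if "a < m" "m \<le> x" for m x
    using that a \<delta> bv by (intro has_variation_integral_powr_lower_bound[OF J]) auto
  \<comment> \<open>As m > a, the weight (m/2)^\<delta> is at least (a/2)^\<delta>, so one bound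
    serves all m down to a.\<close>
  define B where "B = \<bar>J x0\<bar> / (a / 2) powr \<delta>"
  \<comment> \<open>One summand each for blocks reaching beyond \<open>x0\<close>, for the variation
    up to \<open>x0\<close>, and for the size of \<open>L\<close> from \<open>x0\<close> on.\<close>
  define C where "C = K * M * 4 powr \<delta> + B + M"
  have KM: "0 \<le> K * M * 4 powr \<delta>" and B0: "0 \<le> B" using K M by (auto simp: B_def)
  have near: "total_variation L m x0 \<le> B" if "a < m" "m \<le> x0" for m
  proof -
    have "(a / 2) powr \<delta> * total_variation L m x0 \<le> (m / 2) powr \<delta> * total_variation L m x0"
      using that a \<delta> var[OF that] by (intro mult_right_mono powr_mono2) auto
    also have "\<dots> \<le> \<bar>J x0\<bar>" using lower[OF that] by linarith
    finally show ?thesis using a by (simp add: B_def field_simps)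
  qed
  have bounded: "\<bar>L x\<bar> \<le> C" if "a < x" for x
  proof (cases "x0 \<le> x")
    case True
    then show ?thesis using far[OF True] KM B0 by (simp add: C_def)
  next
    case False
    then show ?thesis
      using var[OF that, of x0] near[OF that] far[of x0, THEN conjunct2] KM unfolding C_def by linarith
  qed
  have dyadic: "total_variation L m x \<le> C" if mx: "a < m" "m \<le> x" "x \<le> 2 * m" for m x
  proof (cases "x0 \<le> x")
    case True
    have m: "0 < m" using a mx by simp
    have "(m / 2) powr \<delta> * total_variation L m x \<le> \<bar>J x\<bar>"
      using lower[OF mx(1,2)] by linarith
    also have "\<dots> \<le> K * \<bar>x powr \<delta> * L x\<bar>"
      using far[OF True] by simp
    also have "\<dots> \<le> K * ((4 * (m / 2)) powr \<delta> * M)"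
      using K far[OF True] mx m \<delta> unfolding abs_mult
      by (intro mult_left_mono mult_mono) (auto intro!: powr_mono2)
    \<comment> \<open>The 4 comes from x <= 2 m = 4 (m/2); the remaining power of m/2 cancels
      against the left side.\<close>
    also have "(4 * (m / 2)) powr \<delta> = 4 powr \<delta> * (m / 2) powr \<delta>"
      using m by (subst powr_mult) auto
    finally have "(m / 2) powr \<delta> * total_variation L m x \<le> (m / 2) powr \<delta> * (K * M * 4 powr \<delta>)"
      by (simp add: algebra_simps)
    then have "total_variation L m x \<le> K * M * 4 powr \<delta>"
      using m by simp
    then show ?thesis using B0 M by (simp add: C_def)
  next
    case False
    then have "total_variation L m x \<le> total_variation L m x0"
      using super[OF mx(1,2), of x0] var[of x x0] mx by auto
    then show ?thesis using near[of m] mx False KM M by (simp add: C_def)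
  qed
  have inv: "a < 1 / x" if "0 < x" "x < 1 / a" for x
    using that a by (simp add: field_simps)
  have "dyadically_bounded_variation (\<lambda>x. L (1 / x)) (1 / a) (\<lambda>x y. total_variation L (1 / y) (1 / x)) C"
    unfolding dyadically_bounded_variation_def
  proof (intro conjI ballI allI impI)
    fix x assume "x \<in> {0<..<1 / a}"
    then show "\<bar>L (1 / x)\<bar> \<le> C" using inv[of x] by (intro bounded) auto
  next
    fix x y :: real assume xy: "0 < x" "x \<le> y" "y < 1 / a"
    then have "1 / y \<le> 1 / x" by (intro divide_left_mono) auto
    then show "\<bar>L (1 / y) - L (1 / x)\<bar> \<le> total_variation L (1 / y) (1 / x)"
      using var[of "1 / y" "1 / x"] inv[of y] xy by (simp add: abs_minus_commute)
  next
    fix x y z :: real assume xyz: "0 < x" "x \<le> y" "y \<le> z" "z < 1 / a"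
    then have "1 / y \<le> 1 / x" "1 / z \<le> 1 / y" by (auto intro!: divide_left_mono)
    then show "total_variation L (1 / y) (1 / x) + total_variation L (1 / z) (1 / y) \<le> total_variation L (1 / z) (1 / x)"
      using super[of "1 / z" "1 / y" "1 / x"] inv[of z] xyz by simp
  next
    fix x y :: real assume xy: "0 < x" "x \<le> y" "y < 1 / a" "y \<le> 2 * x"
    then have "1 / y \<le> 1 / x" "1 / x \<le> 2 * (1 / y)" by (auto simp: field_simps)
    then show "total_variation L (1 / y) (1 / x) \<le> C"
      using inv[of y] xy by (intro dyadic) auto
  qed
  then show ?thesis by blast
qed

section \<open>Cyclical long memory\<close>

text \<open>cos(t + \<phi>) combines cos t and cos(t + pi/2) with the coefficients cos \<phi> and
  sin \<phi>, both at most 1 in size, so two fixed phases give convergence uniformly in the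
  phase.\<close>

lemma quasi_monotone_oscillatory_integral:
  assumes L: "quasi_monotone_slowly_varying (1 / b) L" and lim: "(L \<longlongrightarrow> c) at_top"
    and e: "0 < e" "e < 1" and b: "0 < b"
    and int: "\<And>h \<psi>. (\<lambda>x. L (1 / x) * x powr -e * cos (h * x + \<psi>)) integrable_on {0..b}"
  shows "((\<lambda>h. h powr (1 - e) * integral {0..b} (\<lambda>x. L (1 / x) * x powr -e * cos (h * x + \<phi> h))
    - c * Gamma (1 - e) * cos ((1 - e) * pi / 2 + \<phi> h)) \<longlongrightarrow> 0) at_top"
proof -
  let ?I = "\<lambda>h \<psi>. integral {0..b} (\<lambda>x. L (1 / x) * x powr -e * cos (h * x + \<psi>))"
  define E where "E h \<psi> = h powr (1 - e) * ?I h \<psi> - c * Gamma (1 - e) * cos ((1 - e) * pi / 2 + \<psi>)" for h \<psi>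
  obtain C where dyadic:
    "dyadically_bounded_variation (\<lambda>x. L (1 / x)) b (\<lambda>x y. total_variation L (1 / y) (1 / x)) C"
    using quasi_monotone_imp_dyadically_bounded_variation[OF L _ lim] b by auto
  have "((\<lambda>x. L (1 / x)) \<longlongrightarrow> c) (at_right 0)"
    using filterlim_compose[OF lim filterlim_inverse_at_top_right] by (simp add: inverse_eq_divide)
  then have "((\<lambda>h. E h \<psi>) \<longlongrightarrow> c * Gamma (1 - e) * cos ((1 - e) * pi / 2 + \<psi>) - c * Gamma (1 - e) * cos ((1 - e) * pi / 2 + \<psi>)) at_top" for \<psi>
    unfolding E_def by (intro tendsto_diff tendsto_const oscillatory_integral_limit[OF dyadic e b _ int])
  then have E0: "((\<lambda>h. E h \<psi>) \<longlongrightarrow> 0) at_top" for \<psi> by simp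
  have split: "E h (\<phi> h) = cos (\<phi> h) * E h 0 + sin (\<phi> h) * E h (pi / 2)" for h
  proof -
    have trig: "cos (t + \<phi> h) = cos (\<phi> h) * cos (t + 0) + sin (\<phi> h) * cos (t + pi / 2)" for t
      by (simp add: cos_add)
    have "?I h (\<phi> h) = integral {0..b} (\<lambda>x. cos (\<phi> h) * (L (1 / x) * x powr -e * cos (h * x + 0))
        + sin (\<phi> h) * (L (1 / x) * x powr -e * cos (h * x + pi / 2)))"
      by (simp add: cos_add algebra_simps)
    also have "\<dots> = integral {0..b} (\<lambda>x. cos (\<phi> h) * (L (1 / x) * x powr -e * cos (h * x + 0)))
        + integral {0..b} (\<lambda>x. sin (\<phi> h) * (L (1 / x) * x powr -e * cos (h * x + pi / 2)))"
      by (intro integral_add integrable_on_mult_right int)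
    also have "\<dots> = cos (\<phi> h) * ?I h 0 + sin (\<phi> h) * ?I h (pi / 2)"
      by (simp only: integral_mult_right)
    finally have I: "?I h (\<phi> h) = cos (\<phi> h) * ?I h 0 + sin (\<phi> h) * ?I h (pi / 2)" .
    have "p * (c1 * i0 + s1 * i1) - k * (c1 * t0 + s1 * t1) = c1 * (p * i0 - k * t0) + s1 * (p * i1 - k * t1)"
      for p c1 s1 i0 i1 k t0 t1 :: real
      by (simp add: algebra_simps)
    then show ?thesis
      unfolding E_def I trig[of "(1 - e) * pi / 2"] .
  qed
  have "((\<lambda>h. \<bar>E h 0\<bar> + \<bar>E h (pi / 2)\<bar>) \<longlongrightarrow> \<bar>0\<bar> + \<bar>0\<bar>) at_top"
    by (intro tendsto_add tendsto_rabs E0)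
  then have "((\<lambda>h. \<bar>E h 0\<bar> + \<bar>E h (pi / 2)\<bar>) \<longlongrightarrow> 0) at_top" by simp
  then have "((\<lambda>h. E h (\<phi> h)) \<longlongrightarrow> 0) at_top"
  proof (rule Lim_null_comparison[rotated], intro always_eventually allI)
    fix h
    have "\<bar>cos (\<phi> h) * E h 0\<bar> \<le> \<bar>E h 0\<bar>" "\<bar>sin (\<phi> h) * E h (pi / 2)\<bar> \<le> \<bar>E h (pi / 2)\<bar>"
      by (auto simp: abs_mult intro!: mult_left_le_one_le)
    then show "norm (E h (\<phi> h)) \<le> \<bar>E h 0\<bar> + \<bar>E h (pi / 2)\<bar>"
      unfolding split by simp
  qed
  then show ?thesis by (simp add: E_def)
qed

text \<open>Exhibits the radicand of the amplitude as the squared length of a plane vector.\<close>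

lemma cyclical_amplitude_squared:
  "(cp + cm)\<^sup>2 * (sin (pi * d))\<^sup>2 + (cp - cm)\<^sup>2 * (cos (pi * d))\<^sup>2 =
    cp\<^sup>2 + cm\<^sup>2 - 2 * cp * cm * cos (2 * pi * d)"
proof -
  have cos_double: "cos (2 * pi * d) = 1 - 2 * (sin (pi * d))\<^sup>2"
    using cos_double_sin[of "pi * d"] by (simp add: mult.assoc)
  show ?thesis
    unfolding cos_double cos_squared_eq by (simp add: power2_sum power2_diff algebra_simps)
qed

text \<open>The vector ((cp + cm) cos \<theta>, (cp - cm) sin \<theta>) has length A and polar angle
  \<phi>; its first coordinate is positive, so the arcsine picks the right branch.\<close>

lemma cyclical_amplitude_phase:
  fixes cm cp d :: real
  assumes c: "0 < cm" "0 < cp" and d: "0 < d" "d < 1/2"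
  defines "A \<equiv> cyclical_amplitude cm cp d" and "\<theta> \<equiv> (1/2 - d) * pi"
  defines "\<phi> \<equiv> arcsin ((cp - cm) * cos (pi * d) / A)"
  shows "0 < A" "\<phi> \<in> {- \<theta>..\<theta>}"
    and "cp * cos (\<theta> + x) + cm * cos (\<theta> - x) = A * cos (x + \<phi>)"
proof -
  have \<theta>: "0 < \<theta>" "\<theta> < pi / 2" using d by (auto simp: \<theta>_def)
  have "\<theta> = pi / 2 - pi * d" by (simp add: \<theta>_def algebra_simps)
  then have st: "sin \<theta> = cos (pi * d)" "cos \<theta> = sin (pi * d)"
    by (simp_all add: sin_diff cos_diff)
  have pos: "0 < sin \<theta>" "0 < cos \<theta>"
    using \<theta> by (auto intro!: sin_gt_zero2 cos_gt_zero)
  define Q where "Q = (cp + cm)\<^sup>2 * (cos \<theta>)\<^sup>2 + (cp - cm)\<^sup>2 * (sin \<theta>)\<^sup>2"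
  have Q: "0 < Q" unfolding Q_def using c pos by (intro add_pos_nonneg) auto
  have A: "A = sqrt Q"
    unfolding A_def cyclical_amplitude_def Q_def st cyclical_amplitude_squared ..
  show A0: "0 < A" using Q A by simp
  have AQ: "A\<^sup>2 = Q" using Q A by simp
  define u where "u = (cp - cm) * sin \<theta> / A"
  have u2: "u\<^sup>2 + ((cp + cm) * cos \<theta> / A)\<^sup>2 = 1"
  proof -
    have "u\<^sup>2 + ((cp + cm) * cos \<theta> / A)\<^sup>2 = Q / A\<^sup>2"
      by (simp add: u_def Q_def power_mult_distrib power_divide add_divide_distrib)
    then show ?thesis using AQ Q by simp
  qed
  \<comment> \<open>This yields |sin \<phi>| <= sin \<theta> and hence the range of \<phi>.\<close>
  have "(cp - cm)\<^sup>2 \<le> A\<^sup>2"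
  proof -
    have "Q = (cp - cm)\<^sup>2 + 4 * cp * cm * (cos \<theta>)\<^sup>2"
      unfolding Q_def sin_squared_eq by (simp add: power2_sum power2_diff algebra_simps)
    then show ?thesis using c AQ by simp
  qed
  then have "\<bar>cp - cm\<bar> \<le> A" using A0 abs_le_square_iff[of "cp - cm" A] by simp
  then have "\<bar>u\<bar> \<le> sin \<theta>"
    using A0 pos by (simp add: u_def abs_mult abs_divide divide_le_eq mult.commute mult_left_mono)
  then have us: "- sin \<theta> \<le> u" "u \<le> sin \<theta>" by auto
  have u1: "-1 \<le> u" "u \<le> 1"
    by (rule order_trans[OF _ us(1)], simp) (rule order_trans[OF us(2)], simp)
  have \<phi>: "\<phi> = arcsin u" by (simp add: \<phi>_def u_def st)
  have "arcsin (- sin \<theta>) \<le> arcsin u" "arcsin u \<le> arcsin (sin \<theta>)"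
    by (rule arcsin_le_arcsin[OF _ us(1) u1(2)], simp) (rule arcsin_le_arcsin[OF u1(1) us(2)], simp)
  moreover have "arcsin (sin \<theta>) = \<theta>" using \<theta> by (intro arcsin_sin) auto
  moreover have "arcsin (- sin \<theta>) = - \<theta>"
    using \<theta> arcsin_sin[of "- \<theta>"] by simp
  ultimately show "\<phi> \<in> {- \<theta>..\<theta>}" by (simp add: \<phi>)
  have sin\<phi>: "sin \<phi> = u" using u1 by (simp add: \<phi>)
  have "cos \<phi> = sqrt (1 - u\<^sup>2)" using u1 by (simp add: \<phi> cos_arcsin)
  also have "1 - u\<^sup>2 = ((cp + cm) * cos \<theta> / A)\<^sup>2" using u2 by linarith
  also have "sqrt \<dots> = (cp + cm) * cos \<theta> / A"
    using c pos A0 by simp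
  finally have AA: "A * cos \<phi> = (cp + cm) * cos \<theta>" "A * sin \<phi> = (cp - cm) * sin \<theta>"
    using A0 by (auto simp: sin\<phi> u_def)
  have Ax: "A * cos (x + \<phi>) = cos x * (A * cos \<phi>) - sin x * (A * sin \<phi>)"
    by (simp add: cos_add algebra_simps)
  show "cp * cos (\<theta> + x) + cm * cos (\<theta> - x) = A * cos (x + \<phi>)"
    unfolding Ax AA by (simp add: cos_add cos_diff algebra_simps)
qed

lemma set_integrable_times_cos:
  fixes f :: "real \<Rightarrow> real"
  assumes "set_integrable lborel A f"
  shows "set_integrable lborel A (\<lambda>l. cos (h * l + \<psi>) * f l)"
proof (rule set_integrable_bound[OF assms])
  have "(\<lambda>x. indicator A x *\<^sub>R f x) \<in> borel_measurable lborel"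
    using assms by (auto simp: set_integrable_def)
  moreover have "(\<lambda>x. cos (h * x + \<psi>)) \<in> borel_measurable lborel"
    by measurable
  ultimately have "(\<lambda>x. cos (h * x + \<psi>) * (indicator A x *\<^sub>R f x)) \<in> borel_measurable lborel"
    by (rule borel_measurable_times[rotated])
  then show "set_borel_measurable lborel A (\<lambda>l. cos (h * l + \<psi>) * f l)"
    by (simp add: set_borel_measurable_def mult.left_commute)
qed (auto simp: abs_mult intro!: mult_left_le_one_le)

text \<open>The formula starts at h = 1: at h = 0 the value \<open>0 powr _ = 0\<close> would make
  its right side vanish.\<close>

theorem propositionB1:
  fixes M :: "'w measure" and X :: "int \<Rightarrow> 'w \<Rightarrow> real" and f :: "real \<Rightarrow> real"
    and Lm Lp Rm Rp :: "real \<Rightarrow> real" and cm cp l0 d :: real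
  assumes "prob_space M"
    and "second_order_stationary M X"
    and "\<And>n. (LINT \<omega>|M. X n \<omega>) = 0"
    and "spectral_density M X f"
    and "0 < l0" "l0 < pi"
    and "0 < d" "d < 1/2"
    and "\<And>l. 0 < l \<Longrightarrow> l < l0 \<Longrightarrow> f l = (cm + Rm (l0 - l)) * (l0 - l) powr (- 2 * d)"
    and "\<And>l. l0 < l \<Longrightarrow> l < pi \<Longrightarrow> f l = (cp + Rp (l - l0)) * (l - l0) powr (- 2 * d)"
    and "(Rm \<longlongrightarrow> 0) (at_right 0)" "(Rp \<longlongrightarrow> 0) (at_right 0)"
    and "\<And>x. 0 < x \<Longrightarrow> x < l0 \<Longrightarrow> Rm x = Lm (1 / x) - cm"
    and "\<And>x. 0 < x \<Longrightarrow> x < pi - l0 \<Longrightarrow> Rp x = Lp (1 / x) - cp"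
    and "quasi_monotone_slowly_varying (1 / l0) Lm"
    and "quasi_monotone_slowly_varying (1 / (pi - l0)) Lp"
    and "0 < cm" "0 < cp"
    and "Lm \<sim>[at_top] (\<lambda>_. cm)" "Lp \<sim>[at_top] (\<lambda>_. cp)"
  shows "\<exists>c\<^sub>\<gamma> \<phi> R\<^sub>\<gamma>.
    (\<forall>h::nat. 1 \<le> h \<longrightarrow>
       autocovariance M X (int h) = (c\<^sub>\<gamma> * cos (l0 * real h + \<phi>) + R\<^sub>\<gamma> h) * real h powr (2 * d - 1)) \<and>
    R\<^sub>\<gamma> \<longlonglongrightarrow> 0 \<and>
    0 < c\<^sub>\<gamma> \<and>
    \<phi> \<in> {- ((1/2 - d) * pi) .. (1/2 - d) * pi} \<and>
    c\<^sub>\<gamma> = 2 * Gamma (1 - 2 * d) * cyclical_amplitude cm cp d \<and>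
    \<phi> = arcsin ((cp - cm) * cos (pi * d) / cyclical_amplitude cm cp d)"
proof -
  define e where "e = 2 * d"
  define \<theta> where "\<theta> = (1/2 - d) * pi"
  define A where "A = cyclical_amplitude cm cp d"
  define \<phi> where "\<phi> = arcsin ((cp - cm) * cos (pi * d) / A)"
  have e: "0 < e" "e < 1" using assms(7,8) by (auto simp: e_def)
  have \<theta>e: "(1 - e) * pi / 2 = \<theta>" by (simp add: e_def \<theta>_def field_simps)
  define b where "b = pi - l0"
  have b: "0 < b" using assms(6) by (simp add: b_def)
  note phase = cyclical_amplitude_phase[OF assms(17,18,7,8), folded A_def, folded \<theta>_def \<phi>_def]
  have lims: "(Lm \<longlongrightarrow> cm) at_top" "(Lp \<longlongrightarrow> cp) at_top"
    using tendsto_asymp_equiv_cong[OF assms(19)] tendsto_asymp_equiv_cong[OF assms(20)] by auto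

  \<comment> \<open>The autocovariance as an integral over {0..pi}\<close>
  have "set_integrable lborel {-pi<..<pi} f"
    using assms(4) by (simp add: spectral_density_def)
  then have "set_integrable lborel {0<..<pi} f"
    by (rule set_integrable_subset) auto
  \<comment> \<open>All phases are kept, so that every phase relative to the singularity can be
    reached after a shift.\<close>
  then have sint: "set_integrable lborel {0<..<pi} (\<lambda>l. cos (h * l + \<psi>) * f l)" for h \<psi>
    by (rule set_integrable_times_cos)
  then have int: "(\<lambda>l. cos (h * l + \<psi>) * f l) integrable_on {0..pi}" for h \<psi>
    using set_borel_integral_eq_integral(1)[OF sint] by (simp add: integrable_on_Icc_iff_Ioo)
  have acov: "autocovariance M X (int n) = 2 * integral {0..pi} (\<lambda>l. cos (real n * l + 0) * f l)" for n
  proof -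
    have "autocovariance M X (int n) = 2 * (LINT l:{0<..<pi}|lborel. cos (real n * l + 0) * f l)"
      using assms(4) by (simp add: spectral_density_def)
    then show ?thesis
      using set_borel_integral_eq_integral(2)[OF sint[of "real n" 0]] by (simp add: integral_open_interval_real)
  qed

  \<comment> \<open>Moving the singularity to the origin on both sides\<close>
  let ?gm = "\<lambda>h \<psi> x. Lm (1 / x) * x powr -e * cos (h * x + \<psi>)"
  let ?gp = "\<lambda>h \<psi> x. Lp (1 / x) * x powr -e * cos (h * x + \<psi>)"
  \<comment> \<open>Substitution l = l0 + x. An equivalence for every value I transports
    integrability and value together; the end points, where the formula for \<open>f\<close> says
    nothing, drop out on the open interval.\<close>
  have right: "((\<lambda>l. cos (h * l + \<psi>) * f l) has_integral I) {l0..pi} \<longleftrightarrow>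
      (?gp h (h * l0 + \<psi>) has_integral I) {0..b}" for h \<psi> I
  proof -
    have "((\<lambda>l. cos (h * l + \<psi>) * f l) has_integral I) {l0..pi} \<longleftrightarrow>
        ((\<lambda>x. cos (h * (x + l0) + \<psi>) * f (x + l0)) has_integral I) {0..b}"
      using has_integral_shift_real_ivl_iff[of "\<lambda>l. cos (h * l + \<psi>) * f l" I l0 pi l0] by (simp add: b_def)
    also have "\<dots> \<longleftrightarrow> (?gp h (h * l0 + \<psi>) has_integral I) {0..b}"
      unfolding has_integral_Icc_iff_Ioo
    proof (rule has_integral_cong)
      fix x assume "x \<in> {0<..<b}"
      then have x: "0 < x" "x < pi - l0" by (auto simp: b_def)
      have "f (x + l0) = Lp (1 / x) * x powr -e"
        using assms(10)[of "x + l0"] assms(14)[OF x] x by (simp add: e_def)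
      then show "cos (h * (x + l0) + \<psi>) * f (x + l0) = ?gp h (h * l0 + \<psi>) x"
        by (simp add: algebra_simps)
    qed
    finally show ?thesis .
  qed
  \<comment> \<open>Substitution l = l0 - x; the cosine is even, so the phase changes sign.\<close>
  have left: "((\<lambda>l. cos (h * l + \<psi>) * f l) has_integral I) {0..l0} \<longleftrightarrow>
      (?gm h (- (h * l0 + \<psi>)) has_integral I) {0..l0}" for h \<psi> I
  proof -
    have "((\<lambda>l. cos (h * l + \<psi>) * f l) has_integral I) {0..l0} \<longleftrightarrow>
        ((\<lambda>x. cos (h * (- x) + \<psi>) * f (- x)) has_integral I) {- l0..0}"
      using has_integral_reflect_real[of "\<lambda>l. cos (h * l + \<psi>) * f l" I l0 0] by simp
    also have "\<dots> \<longleftrightarrow> ((\<lambda>x. cos (h * (- (x + (- l0))) + \<psi>) * f (- (x + (- l0)))) has_integral I) {0..l0}"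
      using has_integral_shift_real_ivl_iff[of "\<lambda>x. cos (h * (- x) + \<psi>) * f (- x)" I "- l0" 0 "- l0"] by simp
    also have "\<dots> \<longleftrightarrow> (?gm h (- (h * l0 + \<psi>)) has_integral I) {0..l0}"
      unfolding has_integral_Icc_iff_Ioo
    proof (rule has_integral_cong)
      fix x assume "x \<in> {0<..<l0}"
      then have x: "0 < x" "x < l0" by auto
      have fx: "f (- (x + (- l0))) = Lm (1 / x) * x powr -e"
        using assms(9)[of "l0 - x"] assms(13)[OF x] x by (simp add: e_def)
      have "h * (- (x + (- l0))) + \<psi> = - (h * x + (- (h * l0 + \<psi>)))"
        by (simp add: algebra_simps)
      then have cosx: "cos (h * (- (x + (- l0))) + \<psi>) = cos (h * x + (- (h * l0 + \<psi>)))"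
        by (simp only: cos_minus)
      show "cos (h * (- (x + (- l0))) + \<psi>) * f (- (x + (- l0))) = ?gm h (- (h * l0 + \<psi>)) x"
        unfolding fx cosx by (rule mult.commute)
    qed
    finally show ?thesis .
  qed
  have intp: "?gp h \<psi> integrable_on {0..b}" for h \<psi>
  proof -
    have "(\<lambda>l. cos (h * l + (\<psi> - h * l0)) * f l) integrable_on {l0..pi}"
      using integrable_subinterval_real[OF int] assms(5,6) by auto
    then show ?thesis
      unfolding integrable_on_def right by simp
  qed
  have intm: "?gm h \<psi> integrable_on {0..l0}" for h \<psi>
  proof -
    have "(\<lambda>l. cos (h * l + (- \<psi> - h * l0)) * f l) integrable_on {0..l0}"
      using integrable_subinterval_real[OF int] assms(5,6) by auto
    then show ?thesis
      unfolding integrable_on_def left by simp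
  qed
  have split: "integral {0..pi} (\<lambda>l. cos (h * l + 0) * f l) =
      integral {0..l0} (?gm h (- (h * l0))) + integral {0..b} (?gp h (h * l0))" for h
  proof -
    have "((\<lambda>l. cos (h * l + 0) * f l) has_integral integral {0..l0} (?gm h (- (h * l0)))) {0..l0}"
      unfolding left unfolding add_0_right by (rule integrable_integral[OF intm])
    moreover have "((\<lambda>l. cos (h * l + 0) * f l) has_integral integral {0..b} (?gp h (h * l0))) {l0..pi}"
      unfolding right unfolding add_0_right by (rule integrable_integral[OF intp])
    ultimately show ?thesis
      using assms(5,6) by (intro integral_unique has_integral_combine[of 0 l0 pi]) auto
  qed

  \<comment> \<open>Adding the asymptotics of the two sides\<close>
  let ?Em = "\<lambda>h. h powr (1 - e) * integral {0..l0} (?gm h (- (h * l0)))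
    - cm * Gamma (1 - e) * cos ((1 - e) * pi / 2 + - (h * l0))"
  let ?Ep = "\<lambda>h. h powr (1 - e) * integral {0..b} (?gp h (h * l0))
    - cp * Gamma (1 - e) * cos ((1 - e) * pi / 2 + h * l0)"
  have Em: "(?Em \<longlongrightarrow> 0) at_top"
    by (rule quasi_monotone_oscillatory_integral[OF assms(15) lims(1) e assms(5) intm])
  have Ep: "(?Ep \<longlongrightarrow> 0) at_top"
    by (rule quasi_monotone_oscillatory_integral[OF assms(16)[folded b_def] lims(2) e b intp])

  define c where "c = 2 * Gamma (1 - 2 * d) * A"
  define R where "R n = autocovariance M X (int n) * real n powr (1 - e) - c * cos (l0 * real n + \<phi>)" for n :: nat
  have R: "R n = 2 * (?Em (real n) + ?Ep (real n))" for n
  proof -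
    \<comment> \<open>The addition formula at x = n l0; the factor 2 is that of the cosine integral
      for the autocovariance.\<close>
    have ceq: "c * cos (l0 * real n + \<phi>) = 2 * Gamma (1 - e) *
        (cp * cos (\<theta> + real n * l0) + cm * cos (\<theta> - real n * l0))"
      unfolding phase(3) by (simp add: c_def e_def mult.commute)
    show ?thesis
      unfolding R_def acov split \<theta>e ceq by (simp add: algebra_simps)
  qed
  have "((\<lambda>h. 2 * (?Em h + ?Ep h)) \<longlongrightarrow> 2 * (0 + 0)) at_top"
    by (intro tendsto_mult_left tendsto_add Em Ep)
  then have "(\<lambda>n. 2 * (?Em (real n) + ?Ep (real n))) \<longlonglongrightarrow> 2 * (0 + 0)"
    by (rule filterlim_compose[OF _ filterlim_real_sequentially])
  then have "R \<longlonglongrightarrow> 0" unfolding R[symmetric] by simp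
  moreover have "autocovariance M X (int n) = (c * cos (l0 * real n + \<phi>) + R n) * real n powr (2 * d - 1)"
    if "1 \<le> n" for n
  proof -
    have "real n powr (1 - e) * real n powr (2 * d - 1) = 1"
      using that by (simp add: e_def flip: powr_add)
    then show ?thesis by (simp add: R_def mult.assoc)
  qed
  moreover have "0 < c" using e phase(1) by (auto simp: c_def e_def intro!: mult_pos_pos Gamma_real_pos)
  ultimately show ?thesis
    using phase(2) unfolding \<theta>_def
    by (intro exI[of _ c] exI[of _ \<phi>] exI[of _ R]) (auto simp: c_def A_def \<phi>_def)
qed

end
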